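(* Let $b\ge 2$ be an integer, let $\alpha,\lambda>0$, and let $A\subset\mathbb{R}$, $A\notin\{\emptyset,\mathbb{R}\}$, be a finite union of $r_A\ge1$ pairwise disjoint intervals with endpoints $-\infty\le a_j<b_j\le\infty$. With $\nu,m_A,M_A,D_A$ and $Q_A:[0,1]\to[0,\infty]$ as in the context, the following hold. (i) $\{q\in[0,1]:Q_A(q)\in[0,\infty)\}=D_A$, and $Q_A(q)=0$ if and only if $q=\nu(A)$. (ii) $Q_A$ is strictly decreasing on $D_A\cap[m_A,\nu(A)]$ and strictly increasing on $D_A\cap[\nu(A),M_A]$. (iii) $Q_A$ is lower semicontinuous on $[0,1]$. Hence it is right-continuous on $D_A\cap[m_A,\nu(A))$ and left-continuous on $D_A\cap(\nu(A),M_A]$. (iv) The discontinuities of $Q_A$ are jumps and form an at most countable set.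
   Context: $\nu$ is the standard Gaussian measure on $\mathbb{R}$; $g_A(x)=\nu(A-x)$ with $A-x=\{a-x:a\in A\}$; $m_A=\inf_{x\in\mathbb{R}}g_A(x)$, $M_A=\sup_{x\in\mathbb{R}}g_A(x)$, $D_A=\{g_A(x):x\in\mathbb{R}\}$. $\mathbb{T}_b=\bigcup_{k\ge0}\{1,\dots,b\}^k$ is the rooted $b$-ary tree with root $\varnothing$; $|v|$ is the length of $v$. $\mathcal{H}_b$ is the set of real fields $h=(h_v)_{v\in\mathbb{T}_b}$ with $h_\varnothing=0$ and $\|h\|_b:=\sum_{k\ge1}b^{-k}\sum_{|v|=k}|h_v|<\infty$. $\partial\mathbb{T}_b=\{1,\dots,b\}^{\{1,2,\dots\}}$ carries the product $\sigma$-algebra and the product measure $\mathbf{m}_b$ of uniform measures on $\{1,\dots,b\}$; $\xi|k$ is the vector of the first $k$ coordinates of $\xi$. For $h\in\mathcal{H}_b$, $H_h(\xi)=\sum_{k\ge1}h_{\xi|k}$ (absolutely convergent for $\mathbf{m}_b$-a.e. $\xi$), $\Psi_A(h)=\int_{\partial\mathbb{T}_b}g_A(H_h(\xi))\,\mathbf{m}_b(d\xi)$, $\mathcal{I}_\alpha(h)=\lambda\sum_{v\ne\varnothing}|h_v|^\alpha\in[0,\infty]$, and $Q_A(q)=\inf\{\mathcal{I}_\alpha(h):h\in\mathcal{H}_b,\ \Psi_A(h)=q\}$ for $q\in[0,1]$, with $\inf\emptyset=\infty$. Values in $[0,\infty]$ carry the usual topology of the extended half-line. A discontinuity is a jump if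 the one-sided limits exist in $[0,\infty]$ and differ from each other (at an endpoint of $[0,1]$: the only available one-sided limit exists and differs from the value). *)

theory Defs
  imports "HOL-Probability.Probability"
begin

definition gauss :: "real measure" where
  "gauss = density lborel std_normal_density"

definition gA :: "real set \<Rightarrow> real \<Rightarrow> real" where
  "gA A x = measure gauss ((\<lambda>a. a - x) ` A)"

definition mA :: "real set \<Rightarrow> real" where
  "mA A = (INF x. gA A x)"

definition MA :: "real set \<Rightarrow> real" where
  "MA A = (SUP x. gA A x)"

definition DA :: "real set \<Rightarrow> real set" where
  "DA A = range (gA A)"

text \<open>The real intervals with endpoints \<open>lo\<close> and \<open>hi\<close> in the extended reals; infinite
  endpoints never belong to the interval, since only its real points are kept.\<close>

definition real_intervals :: "ereal \<Rightarrow> ereal \<Rightarrow> real set set" where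
  "real_intervals lo hi =
    {ereal -` {lo<..<hi}, ereal -` {lo..<hi}, ereal -` {lo<..hi}, ereal -` {lo..hi}}"

definition tree :: "nat \<Rightarrow> nat list set" where
  "tree b = lists {1..b}"

definition tree_level :: "nat \<Rightarrow> nat \<Rightarrow> nat list set" where
  "tree_level b k = {v \<in> tree b. length v = k}"

text \<open>The series is over \<open>k \<ge> 1\<close>, whence the shift to \<open>Suc k\<close>.\<close>

definition field_norm :: "nat \<Rightarrow> (nat list \<Rightarrow> real) \<Rightarrow> ennreal" where
  "field_norm b h =
    (\<Sum>k. ennreal ((1 / real b ^ Suc k) * (\<Sum>v\<in>tree_level b (Suc k). \<bar>h v\<bar>)))"

text \<open>A field on the tree is a function on all lists of which only the values on \<open>tree b\<close>
  are ever used.\<close>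

definition fields :: "nat \<Rightarrow> (nat list \<Rightarrow> real) set" where
  "fields b = {h. h [] = 0 \<and> field_norm b h < \<infinity>}"

text \<open>Boundary points are functions on the index set \<open>{1..}\<close> of positive integers.\<close>

definition boundary_measure :: "nat \<Rightarrow> (nat \<Rightarrow> nat) measure" where
  "boundary_measure b = PiM {1..} (\<lambda>_. uniform_count_measure {1..b})"

definition prefix_of :: "(nat \<Rightarrow> nat) \<Rightarrow> nat \<Rightarrow> nat list" where
  "prefix_of \<xi> k = map \<xi> [1..<Suc k]"

text \<open>For \<open>h\<close> in \<open>fields b\<close> the series converges absolutely for almost every \<open>\<xi>\<close>; its
  value on the remaining null set is irrelevant.\<close>

definition ray_sum :: "(nat list \<Rightarrow> real) \<Rightarrow> (nat \<Rightarrow> nat) \<Rightarrow> real" where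
  "ray_sum h \<xi> = (\<Sum>k. h (prefix_of \<xi> (Suc k)))"

definition Psi :: "nat \<Rightarrow> real set \<Rightarrow> (nat list \<Rightarrow> real) \<Rightarrow> real" where
  "Psi b A h = (\<integral>\<xi>. gA A (ray_sum h \<xi>) \<partial>boundary_measure b)"

definition cost :: "nat \<Rightarrow> real \<Rightarrow> real \<Rightarrow> (nat list \<Rightarrow> real) \<Rightarrow> ennreal" where
  "cost b \<alpha> lam h =
    ennreal lam * (\<Sum>\<^sub>\<infinity>v\<in>tree b - {[]}. ennreal (\<bar>h v\<bar> powr \<alpha>))"

definition QA :: "nat \<Rightarrow> real \<Rightarrow> real \<Rightarrow> real set \<Rightarrow> real \<Rightarrow> ennreal" where
  "QA b \<alpha> lam A q = Inf {cost b \<alpha> lam h |h. h \<in> fields b \<and> Psi b A h = q}"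

definition lower_semicontinuous_on :: "real set \<Rightarrow> (real \<Rightarrow> ennreal) \<Rightarrow> bool" where
  "lower_semicontinuous_on S f \<longleftrightarrow>
    (\<forall>x\<in>S. \<forall>c. c < f x \<longrightarrow> eventually (\<lambda>y. c < f y) (at x within S))"

definition discontinuities :: "(real \<Rightarrow> ennreal) \<Rightarrow> real set" where
  "discontinuities f = {q \<in> {0..1}. \<not> continuous (at q within {0..1}) f}"

text \<open>Jumps of a function on \<open>[0,1]\<close>: at an endpoint the only available one-sided limit is
  compared with the value.\<close>

definition is_jump :: "(real \<Rightarrow> ennreal) \<Rightarrow> real \<Rightarrow> bool" where
  "is_jump f q \<longleftrightarrow>
    (if q = 0 then \<exists>r. (f \<longlongrightarrow> r) (at_right q) \<and> r \<noteq> f q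
     else if q = 1 then \<exists>l. (f \<longlongrightarrow> l) (at_left q) \<and> l \<noteq> f q
     else \<exists>l r. (f \<longlongrightarrow> l) (at_left q) \<and> (f \<longlongrightarrow> r) (at_right q) \<and> l \<noteq> r)"

end

theory Submission
  imports Defs "HOL-Complex_Analysis.Great_Picard"
begin

text \<open>Bounded energy forces uniformly small tails in the series defining \<open>field_norm\<close>, so energy
  sublevel sets are compact for that norm, for which \<open>Psi\<close> is Lipschitz because \<open>gA A\<close> is. Hence the
  infimum \<open>QA\<close> is attained and lower semicontinuous. Scaling an optimal field towards \<open>0\<close> moves
  \<open>Psi\<close> continuously to \<open>measure gauss A\<close> while strictly lowering the energy, which gives strict
  monotonicity on both sides of this point. With lower semicontinuity, monotonicity leaves only
  countably many jumps, apart from a possible spike at \<open>measure gauss A\<close> itself. There at least one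
  one-sided limit is \<open>0\<close>: otherwise \<open>gA A\<close> would be constant near \<open>0\<close>, hence everywhere by
  analyticity, and equal to its limit \<open>0\<close> or \<open>1\<close> at infinity.\<close>

section \<open>The Gaussian profile of a finite union of intervals\<close>

lemma real_distribution_gauss: "real_distribution gauss"
proof -
  interpret prob_space gauss
    unfolding gauss_def by (rule prob_space_normal_density) simp
  show ?thesis by standard (simp_all add: gauss_def)
qed

interpretation gauss: real_distribution gauss
  by (rule real_distribution_gauss)

text \<open>Points are null sets, so open and closed endpoints of an interval can be
  exchanged.\<close>

lemma AE_gauss_neq: "AE y in gauss. y \<noteq> c"
  unfolding gauss_def by (subst AE_density) (use AE_lborel_singleton[of c] in \<open>auto elim: eventually_mono\<close>)

lemma continuous_std_normal_density: "continuous_on S std_normal_density"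
  unfolding std_normal_density_def by (intro continuous_intros) auto

text \<open>Passing from the half-open to the closed interval costs nothing without atoms. The gauge
  integral on a compact interval is the form that the fundamental theorem of calculus needs.\<close>

lemma cdf_gauss_diff:
  assumes "a \<le> b" shows "cdf gauss b - cdf gauss a = integral {a..b} std_normal_density"
proof -
  have "cdf gauss b - cdf gauss a = measure gauss {a<..b}"
  proof (cases "a < b")
    case True then show ?thesis by (rule gauss.cdf_diff_eq)
  qed (use assms in auto)
  also have "\<dots> = measure gauss {a..b}"
    by (intro measure_eq_AE) (use AE_gauss_neq[of a] in \<open>auto elim: eventually_mono\<close>)
  also have "\<dots> = (LINT x|lborel. indicator {a..b} x *\<^sub>R std_normal_density x)"
    unfolding gauss_def measure_def
    apply (subst emeasure_density)
      apply (auto)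
    apply (subst integral_eq_nn_integral)
      apply (auto simp: mult.commute intro!: arg_cong[where f=enn2real] nn_integral_cong split: split_indicator)
    done
  also have "\<dots> = integral {a..b} std_normal_density"
    using set_borel_integral_eq_integral(2)[OF borel_integrable_atLeastAtMost'[OF continuous_std_normal_density], of a b]
    by (simp add: set_lebesgue_integral_def)
  finally show ?thesis .
qed

lemma cdf_gauss_has_derivative:
  "(cdf gauss has_real_derivative std_normal_density t) (at t)"
proof -
  \<comment> \<open>Any compact interval with \<open>t\<close> in its interior would do: the
    derivative within it is then a two-sided derivative.\<close>
  define a b where "a = t - 1" and "b = t + 1"
  have "((\<lambda>x. integral {a..x} std_normal_density) has_real_derivative std_normal_density t) (at t within {a..b})"
    by (intro integral_has_real_derivative continuous_std_normal_density) (auto simp: a_def b_def)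
  then have "((\<lambda>x. cdf gauss a + integral {a..x} std_normal_density) has_real_derivative std_normal_density t) (at t within {a..b})"
    by (auto intro!: derivative_eq_intros)
  then have "(cdf gauss has_real_derivative std_normal_density t) (at t within {a..b})"
    by (rule has_field_derivative_transform_within[where d = 1])
      (auto simp: a_def b_def cdf_gauss_diff[symmetric])
  moreover have "at t within {a..b} = at t"
    by (rule at_within_interior) (simp add: a_def b_def)
  ultimately show ?thesis by simp
qed

text \<open>The Gaussian distribution function with infinite arguments allowed, so that bounded and
  unbounded intervals share one formula.\<close>

definition gcdf :: "ereal \<Rightarrow> real" where
  "gcdf e = measure gauss (ereal -` {..e})"

text \<open>Zero at infinite endpoints, because a shift does not move them and they contribute a
  constant to the profile.\<close>

definition gdens :: "ereal \<Rightarrow> real \<Rightarrow> real" where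
  "gdens e x = (if \<bar>e\<bar> = \<infinity> then 0 else std_normal_density (real_of_ereal e - x))"

lemma gcdf_ereal [simp]: "gcdf (ereal c) = cdf gauss c"
  by (simp add: gcdf_def cdf_def vimage_def atMost_def)

lemma gcdf_infty [simp]: "gcdf \<infinity> = 1" "gcdf (-\<infinity>) = 0"
proof -
  have "ereal -` {..\<infinity>} = UNIV" "ereal -` {..- \<infinity>} = {}" by auto
  then show "gcdf \<infinity> = 1" "gcdf (-\<infinity>) = 0"
    using gauss.prob_space by (simp_all only: gcdf_def gauss.space_eq_univ measure_empty)
qed

lemma gcdf_shift_has_derivative:
  "((\<lambda>x. gcdf (e - ereal x)) has_real_derivative - gdens e t) (at t)"
proof (cases e)
  case (real c)
  have "((\<lambda>x. cdf gauss (c - x)) has_real_derivative - std_normal_density (c - t)) (at t)"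
    by (rule DERIV_chain2[OF cdf_gauss_has_derivative, where g = "\<lambda>x. c - x" and Db = "-1", simplified])
      (auto intro!: derivative_eq_intros)
  with real show ?thesis by (simp add: gdens_def)
qed (simp_all add: gdens_def)

text \<open>Infinite endpoints stay put under the shift, while finite ones are carried to minus
  infinity.\<close>

lemma gcdf_shift_tendsto:
  "((\<lambda>x. gcdf (e - ereal x)) \<longlongrightarrow> (if e = \<infinity> then 1 else 0)) at_top"
proof (cases e)
  case (real c)
  have "((\<lambda>x. cdf gauss (c - x)) \<longlongrightarrow> 0) at_top"
    using gauss.cdf_lim_at_bot
    by (rule filterlim_compose) (auto simp: filterlim_uminus_at_bot intro!: filterlim_tendsto_add_at_top[of "\<lambda>_. -c", simplified] filterlim_ident)
  with real show ?thesis by simp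
qed simp_all

lemma ereal_vimage_borel: "S \<in> sets borel \<Longrightarrow> ereal -` S \<in> sets borel"
  using measurable_sets[of ereal borel borel S] by simp

lemma real_intervals_shift:
  assumes "lo < hi" "I \<in> real_intervals lo hi"
  shows "(\<lambda>a. a - x) ` I \<in> sets borel"
    and "measure gauss ((\<lambda>a. a - x) ` I) = gcdf (hi - ereal x) - gcdf (lo - ereal x)"
proof -
  have image: "(\<lambda>a. a - x) ` S = (\<lambda>y. y + x) -` S" for S :: "real set"
    by (auto simp: image_iff) (metis add_diff_cancel_right' )
  have I: "I \<in> sets borel"
    using assms(2) by (auto simp: real_intervals_def intro!: ereal_vimage_borel)
  then show 1: "(\<lambda>a. a - x) ` I \<in> sets borel"
    unfolding image by (intro measurable_sets_borel[where M=borel]) auto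
  have sh: "ereal y \<le> e - ereal x \<longleftrightarrow> ereal (y + x) \<le> e" for e y
    by (cases e) (auto simp: le_diff_eq)
  have meas: "ereal -` {..e} \<in> sets borel" for e
    by (intro ereal_vimage_borel) simp
  have "measure gauss ((\<lambda>a. a - x) ` I) = measure gauss (ereal -` {..hi - x} - ereal -` {..lo - x})"
  proof (rule measure_eq_AE)
    \<comment> \<open>For an infinite endpoint \<open>real_of_ereal\<close> returns 0, which merely
      discards one more null point. Off these points the four kinds of interval agree.\<close>
    have "AE y in gauss. y \<noteq> real_of_ereal lo - x" "AE y in gauss. y \<noteq> real_of_ereal hi - x"
      by (rule AE_gauss_neq)+
    then show "AE y in gauss. y \<in> (\<lambda>a. a - x) ` I \<longleftrightarrow> y \<in> ereal -` {..hi - x} - ereal -` {..lo - x}"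
    proof eventually_elim
      case (elim y)
      then have "ereal (y + x) \<noteq> lo" "ereal (y + x) \<noteq> hi" by auto
      then show ?case
        using assms(2) unfolding image real_intervals_def by (auto simp: sh not_le less_le)
    qed
  qed (use 1 meas in auto)
  also have "\<dots> = gcdf (hi - x) - gcdf (lo - x)"
    unfolding gcdf_def
  proof (rule gauss.finite_measure_Diff)
    have "lo - ereal x \<le> hi - ereal x"
      using assms(1) by (intro ereal_minus_mono) auto
    then show "ereal -` {..lo - ereal x} \<subseteq> ereal -` {..hi - ereal x}" by auto
  qed (use meas in auto)
  finally show "measure gauss ((\<lambda>a. a - x) ` I) = gcdf (hi - ereal x) - gcdf (lo - ereal x)" .
qed

section \<open>Smoothness, limit and rigidity of the profile\<close>

locale interval_union =
  fixes r :: nat and A :: "real set" and J :: "nat \<Rightarrow> real set" and lo hi :: "nat \<Rightarrow> ereal"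
  assumes lo_less_hi: "\<And>j. j < r \<Longrightarrow> lo j < hi j"
    and J: "\<And>j. j < r \<Longrightarrow> J j \<in> real_intervals (lo j) (hi j)"
    and disjoint: "disjoint_family_on J {..<r}"
    and A_eq: "A = (\<Union>j<r. J j)"
begin

lemma gA_eq: "gA A x = (\<Sum>j<r. gcdf (hi j - ereal x) - gcdf (lo j - ereal x))"
proof -
  have "gA A x = measure gauss (\<Union>j<r. (\<lambda>a. a - x) ` J j)"
    unfolding gA_def A_eq by (simp add: image_UN)
  also have "\<dots> = (\<Sum>j<r. measure gauss ((\<lambda>a. a - x) ` J j))"
  proof (rule gauss.finite_measure_finite_Union)
    show "disjoint_family_on (\<lambda>j. (\<lambda>a. a - x) ` J j) {..<r}"
      unfolding disjoint_family_on_def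
    proof (intro ballI impI)
      fix i j assume "i \<in> {..<r}" "j \<in> {..<r}" "i \<noteq> j"
      with disjoint have "J i \<inter> J j = {}" by (rule disjoint_family_onD)
      then show "(\<lambda>a. a - x) ` J i \<inter> (\<lambda>a. a - x) ` J j = {}" by auto
    qed
  qed (auto simp: real_intervals_shift(1)[OF lo_less_hi J])
  also have "\<dots> = (\<Sum>j<r. gcdf (hi j - ereal x) - gcdf (lo j - ereal x))"
    by (intro sum.cong refl real_intervals_shift(2) lo_less_hi J) auto
  finally show ?thesis .
qed

definition gA_deriv :: "real \<Rightarrow> real" where
  "gA_deriv x = (\<Sum>j<r. gdens (lo j) x - gdens (hi j) x)"

lemma gA_has_derivative: "(gA A has_real_derivative gA_deriv x) (at x)"
  unfolding gA_eq[abs_def] gA_deriv_def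
  by (auto intro!: derivative_eq_intros gcdf_shift_has_derivative sum.cong)

lemma gdens_bounds: "0 \<le> gdens e x" "gdens e x \<le> 1"
proof -
  have "exp (- (t\<^sup>2) / 2) / sqrt (2 * pi) \<le> 1 / 1" for t :: real
    using pi_gt3 by (intro frac_le) (auto intro!: real_le_rsqrt)
  then have "std_normal_density t \<le> 1" for t
    by (simp add: std_normal_density_def)
  then show "0 \<le> gdens e x" "gdens e x \<le> 1" by (auto simp: gdens_def)
qed

text \<open>The derivative is a sum of \<open>r\<close> differences of numbers in the unit interval,
  so each interval contributes at most 1 to the Lipschitz constant.\<close>

lemma gA_lipschitz: "\<bar>gA A x - gA A y\<bar> \<le> real r * \<bar>x - y\<bar>"
proof -
  have "\<bar>gdens (lo j) t - gdens (hi j) t\<bar> \<le> 1" for j t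
    using gdens_bounds[of "lo j" t] gdens_bounds[of "hi j" t] by auto
  then have "\<bar>gA_deriv t\<bar> \<le> real r" for t
    unfolding gA_deriv_def by (intro order_trans[OF sum_abs] sum_bounded_above[where K = 1, simplified, THEN order_trans]) auto
  then show ?thesis
    using field_differentiable_bound[of UNIV "gA A" gA_deriv "real r" x y] gA_has_derivative
    by auto
qed

text \<open>In the limit each endpoint contributes 0 or 1 up to sign. Integrality together with the
  bounds on a probability will leave only the values 0 and 1.\<close>

lemma gA_tendsto: "\<exists>n. (gA A \<longlongrightarrow> of_int n) at_top"
proof -
  let ?l = "\<lambda>e. if e = (\<infinity>::ereal) then 1 else 0 :: int"
  have "(gA A \<longlongrightarrow> (\<Sum>j<r. (if hi j = \<infinity> then 1 else 0) - (if lo j = \<infinity> then 1 else 0))) at_top"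
    unfolding gA_eq[abs_def] by (intro tendsto_intros gcdf_shift_tendsto)
  also have "(\<Sum>j<r. (if hi j = \<infinity> then 1 else 0) - (if lo j = \<infinity> then 1 else 0 :: real))
      = of_int (\<Sum>j<r. ?l (hi j) - ?l (lo j))"
    unfolding of_int_sum by (intro sum.cong) auto
  finally show ?thesis by blast
qed

text \<open>\<open>gA_deriv\<close> extends to an entire function, so it vanishes everywhere once it vanishes near
  the origin; then \<open>gA A\<close> is constant and equals its integer limit at infinity.\<close>

lemma gA_locally_constant:
  assumes "0 < e" and const: "\<And>x. \<bar>x\<bar> < e \<Longrightarrow> gA A x = gA A 0"
  shows "gA A 0 = 0 \<or> gA A 0 = 1"
proof -
  \<comment> \<open>The entire extension of \<open>gdens\<close>, obtained by letting the shift
    become complex.\<close>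
  define cd :: "ereal \<Rightarrow> complex \<Rightarrow> complex" where
    "cd a z = (if \<bar>a\<bar> = \<infinity> then 0 else exp (- (of_real (real_of_ereal a) - z)\<^sup>2 / 2) / of_real (sqrt (2 * pi)))" for a z
  define F where "F z = (\<Sum>j<r. cd (lo j) z - cd (hi j) z)" for z
  have cd: "cd a (of_real x) = of_real (gdens a x)" for a x
    by (simp add: cd_def gdens_def std_normal_density_def flip: exp_of_real)
  then have F: "F (of_real x) = of_real (gA_deriv x)" for x
    by (simp add: F_def gA_deriv_def)
  have "(\<lambda>z. cd a z) holomorphic_on UNIV" for a
    by (cases "\<bar>a\<bar> = \<infinity>") (auto simp: cd_def intro!: holomorphic_intros)
  then have holo: "F holomorphic_on UNIV"
    unfolding F_def by (intro holomorphic_intros)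
  have local0: "gA_deriv x = 0" if "\<bar>x\<bar> < e" for x
  proof -
    have "((\<lambda>_. gA A 0) has_real_derivative gA_deriv x) (at x)"
      by (rule has_field_derivative_transform_within_open[OF gA_has_derivative, where S = "{-e<..<e}"])
        (use that in \<open>auto intro!: const\<close>)
    then show ?thesis using DERIV_const DERIV_unique by blast
  qed
  \<comment> \<open>Analytic continuation needs zeros that accumulate at a point; positive reals
    tending to 0 serve.\<close>
  have "(0::complex) islimpt (of_real ` {0<..<e})"
    unfolding islimpt_approachable
  proof (intro allI impI)
    fix d :: real assume "d > 0"
    define t where "t = min d e / 2"
    have "0 < t" "t < e" "t < d"
      using \<open>0 < d\<close> \<open>0 < e\<close> by (auto simp: t_def min_def)
    then show "\<exists>x'\<in>of_real ` {0<..<e}. x' \<noteq> (0::complex) \<and> dist x' 0 < d"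
      by (intro bexI[of _ "of_real t"]) auto
  qed
  then have "F z = 0" for z
    by (rule analytic_continuation[OF holo open_UNIV connected_UNIV subset_UNIV UNIV_I])
      (auto simp: F local0)
  then have "gA_deriv x = 0" for x
    using F[of x] by simp
  then have "\<forall>x. (gA A has_real_derivative 0) (at x)"
    using gA_has_derivative by metis
  then have const': "gA A x = gA A 0" for x
    by (rule DERIV_isconst_all)
  obtain n where "(gA A \<longlongrightarrow> of_int n) at_top"
    using gA_tendsto by blast
  moreover have "gA A = (\<lambda>_. gA A 0)"
    using const' by auto
  ultimately have "((\<lambda>x::real. gA A 0) \<longlongrightarrow> of_int n) at_top"
    by metis
  then have "gA A 0 = of_int n"
    by (simp add: tendsto_const_iff)
  moreover have "0 \<le> gA A 0" "gA A 0 \<le> 1" by (auto simp: gA_def)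
  ultimately have "0 \<le> n" "n \<le> 1" by auto
  then show ?thesis using \<open>gA A 0 = of_int n\<close> by (cases "n = 0") auto
qed

end

section \<open>Random rays in the tree\<close>

text \<open>For \<open>b \<ge> 1\<close> this is the mean of the absolute values on level
  \<open>k\<close>, that is, their expectation at the \<open>k\<close>-th vertex of a random
  ray.\<close>

definition level_avg :: "nat \<Rightarrow> nat \<Rightarrow> (nat list \<Rightarrow> real) \<Rightarrow> real" where
  "level_avg b k h = (1 / real b ^ k) * (\<Sum>v\<in>tree_level b k. \<bar>h v\<bar>)"

lemma field_norm_eq: "field_norm b h = (\<Sum>k. ennreal (level_avg b (Suc k) h))"
  by (simp add: field_norm_def level_avg_def)

lemma level_avg_nonneg: "0 \<le> level_avg b k h"
  by (simp add: level_avg_def sum_nonneg)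

lemma tree_level_eq: "tree_level b k = {v. set v \<subseteq> {1..b} \<and> length v = k}"
  by (auto simp: tree_level_def tree_def lists_eq_set)

lemma finite_tree_level [simp]: "finite (tree_level b k)"
  by (simp add: tree_level_eq finite_lists_length_eq)

lemma card_tree_level: "card (tree_level b k) = b ^ k"
  by (simp add: tree_level_eq card_lists_length_eq)

lemma tree_level_subset: "tree_level b (Suc k) \<subseteq> tree b - {[]}"
  by (auto simp: tree_level_def)

locale branching =
  fixes b :: nat
  assumes b_pos: "b \<ge> 1"
begin

sublocale bd: product_prob_space "\<lambda>_. uniform_count_measure {1..b}" "{1..}::nat set"
proof -
  have "prob_space (uniform_count_measure {1..b})"
    using b_pos by (intro prob_space_uniform_count_measure) auto
  then show "product_prob_space (\<lambda>_::nat. uniform_count_measure {1..b})"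
    by (simp add: product_prob_space_def product_prob_space_axioms_def product_sigma_finite_def
        prob_space_imp_sigma_finite)
qed

abbreviation "\<mu> \<equiv> boundary_measure b"

sublocale mu: prob_space \<mu>
  unfolding boundary_measure_def by (rule bd.prob_space_axioms)

lemma space_\<mu>: "\<xi> \<in> space \<mu> \<Longrightarrow> i \<ge> 1 \<Longrightarrow> \<xi> i \<in> {1..b}"
  by (auto simp: boundary_measure_def space_PiM space_uniform_count_measure PiE_iff)

lemma prefix_in_level: "\<xi> \<in> space \<mu> \<Longrightarrow> prefix_of \<xi> k \<in> tree_level b k"
  using space_\<mu> by (fastforce simp: tree_level_eq prefix_of_def)

text \<open>Puts a prefix event into the coordinatewise form of a cylinder. Rays are indexed from 1
  and lists from 0, whence \<open>i - 1\<close>.\<close>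

lemma prefix_eq_iff: "length v = k \<Longrightarrow> prefix_of \<xi> k = v \<longleftrightarrow> (\<forall>i\<in>{1..k}. \<xi> i \<in> {v ! (i - 1)})"
proof -
  assume k: "length v = k"
  have "prefix_of \<xi> k = v \<longleftrightarrow> (\<forall>j<k. \<xi> (Suc j) = v ! j)"
    using k by (auto simp: list_eq_iff_nth_eq prefix_of_def simp del: upt_Suc)
  also have "\<dots> \<longleftrightarrow> (\<forall>i\<in>{1..k}. \<xi> i \<in> {v ! (i - 1)})"
  proof (intro iffI allI ballI impI)
    fix i assume "\<forall>j<k. \<xi> (Suc j) = v ! j" "i \<in> {1..k}"
    then show "\<xi> i \<in> {v ! (i - 1)}" by (cases i) auto
  qed auto
  finally show ?thesis .
qed

lemma prefix_cylinder:
  assumes "v \<in> tree_level b k"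
  shows "{\<xi>\<in>space \<mu>. prefix_of \<xi> k = v} \<in> sets \<mu>"
    and "emeasure \<mu> {\<xi>\<in>space \<mu>. prefix_of \<xi> k = v} = ennreal (1 / real b ^ k)"
proof -
  have len: "length v = k" and set: "set v \<subseteq> {1..b}"
    using assms by (auto simp: tree_level_eq)
  have v: "v ! (i - 1) \<in> {1..b}" if "i \<in> {1..k}" for i
    using that len set by (metis One_nat_def Suc_le_eq Suc_pred' atLeastAtMost_iff nth_mem subsetD)
  have eq: "{\<xi>\<in>space \<mu>. prefix_of \<xi> k = v} = {\<xi>\<in>space \<mu>. \<forall>i\<in>{1..k}. \<xi> i \<in> {v ! (i - 1)}}"
    using prefix_eq_iff[OF len] by auto
  have "emeasure \<mu> {\<xi>\<in>space \<mu>. prefix_of \<xi> k = v}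
      = (\<Prod>i\<in>{1..k}. emeasure (uniform_count_measure {1..b}) {v ! (i - 1)})"
    unfolding eq unfolding boundary_measure_def
    by (rule bd.emeasure_PiM_Collect) (use v in \<open>auto simp: sets_uniform_count_measure\<close>)
  also have "\<dots> = (\<Prod>i\<in>{1..k}. ennreal (1 / real b))"
    using v by (intro prod.cong refl) (subst emeasure_uniform_count_measure, auto)
  also have "\<dots> = ennreal (1 / real b ^ k)"
    by (simp add: prod_ennreal ennreal_power power_one_over)
  finally show *: "emeasure \<mu> {\<xi>\<in>space \<mu>. prefix_of \<xi> k = v} = ennreal (1 / real b ^ k)" .
  \<comment> \<open>Sets outside the \<sigma>-algebra have \<open>emeasure\<close> 0 by convention,
    so a positive value proves measurability.\<close>
  show "{\<xi>\<in>space \<mu>. prefix_of \<xi> k = v} \<in> sets \<mu>"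
    using b_pos by (intro emeasure_neq_0_sets) (simp add: *)
qed

text \<open>The cylinders of level \<open>k\<close> partition the space, so a function of the prefix
  is a finite combination of indicators. Measurability and integrals both follow from this.\<close>

lemma prefix_decompose:
  assumes "\<xi> \<in> space \<mu>"
  shows "f (prefix_of \<xi> k) = (\<Sum>v\<in>tree_level b k. f v * indicator {\<xi>\<in>space \<mu>. prefix_of \<xi> k = v} \<xi> :: 'a::semiring_1)"
proof -
  have "(\<Sum>v\<in>tree_level b k. f v * indicator {\<xi>\<in>space \<mu>. prefix_of \<xi> k = v} \<xi>)
      = (\<Sum>v\<in>tree_level b k. if v = prefix_of \<xi> k then f v else 0)"
    using assms by (intro sum.cong) (auto simp: indicator_def)
  then show ?thesis
    using prefix_in_level[OF assms, of k] by simp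
qed

lemma measurable_prefix [measurable]: "(\<lambda>\<xi>. h (prefix_of \<xi> k)) \<in> borel_measurable \<mu>" for h :: "nat list \<Rightarrow> real"
  by (subst measurable_cong[OF prefix_decompose], assumption) (use prefix_cylinder(1) in measurable)

lemma measurable_ray_sum [measurable]: "ray_sum h \<in> borel_measurable \<mu>"
  unfolding ray_sum_def[abs_def] by measurable

lemma nn_integral_prefix: "(\<integral>\<^sup>+\<xi>. ennreal \<bar>h (prefix_of \<xi> k)\<bar> \<partial>\<mu>) = ennreal (level_avg b k h)"
proof -
  have "(\<integral>\<^sup>+\<xi>. ennreal \<bar>h (prefix_of \<xi> k)\<bar> \<partial>\<mu>)
      = (\<integral>\<^sup>+\<xi>. (\<Sum>v\<in>tree_level b k. ennreal \<bar>h v\<bar> * indicator {\<xi>\<in>space \<mu>. prefix_of \<xi> k = v} \<xi>) \<partial>\<mu>)"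
    by (intro nn_integral_cong prefix_decompose)
  also have "\<dots> = (\<Sum>v\<in>tree_level b k. ennreal \<bar>h v\<bar> * ennreal (1 / real b ^ k))"
    using prefix_cylinder by (subst nn_integral_sum) (auto simp: nn_integral_cmult_indicator intro!: sum.cong)
  also have "\<dots> = ennreal (level_avg b k h)"
    by (simp add: level_avg_def sum_distrib_left mult.commute ennreal_mult' sum_ennreal flip: ennreal_mult)
  finally show ?thesis .
qed

text \<open>Exchanging sum and integral identifies \<open>field_norm\<close> with the expected
  absolute sum along a random ray.\<close>

lemma nn_integral_ray: "(\<integral>\<^sup>+\<xi>. (\<Sum>k. ennreal \<bar>h (prefix_of \<xi> (Suc k))\<bar>) \<partial>\<mu>) = field_norm b h"
  by (subst nn_integral_suminf) (auto simp: nn_integral_prefix field_norm_eq)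

lemma AE_ray_summable:
  assumes "field_norm b h < \<infinity>"
  shows "AE \<xi> in \<mu>. summable (\<lambda>k. \<bar>h (prefix_of \<xi> (Suc k))\<bar>)"
proof -
  have "AE \<xi> in \<mu>. (\<Sum>k. ennreal \<bar>h (prefix_of \<xi> (Suc k))\<bar>) \<noteq> \<infinity>"
    using assms by (intro nn_integral_PInf_AE) (auto simp: nn_integral_ray)
  then show ?thesis
    by eventually_elim (auto intro!: summable_suminf_not_top)
qed

end

section \<open>Dependence of \<open>Psi\<close> on the field\<close>

locale field_setting = interval_union + branching
begin

lemma gA_measurable [measurable]: "gA A \<in> borel_measurable borel"
  using gA_has_derivative by (intro borel_measurable_continuous_onI DERIV_continuous_on) auto

lemma gA_bounds: "0 \<le> gA A x" "gA A x \<le> 1"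
  by (auto simp: gA_def)

lemma integrable_gA_ray: "integrable \<mu> (\<lambda>\<xi>. gA A (ray_sum h \<xi>))"
  by (rule mu.integrable_const_bound[where B = 1]) (auto simp: gA_bounds)

text \<open>The Lipschitz bound for \<open>gA A\<close> is applied ray by ray and integrated; the
  expected absolute difference along a ray is the norm of the difference field.\<close>

lemma Psi_lipschitz:
  assumes "field_norm b h < \<infinity>" "field_norm b h' < \<infinity>"
  shows "ennreal \<bar>Psi b A h - Psi b A h'\<bar> \<le> ennreal (real r) * field_norm b (\<lambda>v. h v - h' v)"
proof -
  have "\<bar>Psi b A h - Psi b A h'\<bar> \<le> (\<integral>\<xi>. \<bar>gA A (ray_sum h \<xi>) - gA A (ray_sum h' \<xi>)\<bar> \<partial>\<mu>)"
    unfolding Psi_def by (subst Bochner_Integration.integral_diff[symmetric])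
      (auto intro: integrable_gA_ray integral_abs_bound)
  then have "ennreal \<bar>Psi b A h - Psi b A h'\<bar> \<le> ennreal (\<integral>\<xi>. \<bar>gA A (ray_sum h \<xi>) - gA A (ray_sum h' \<xi>)\<bar> \<partial>\<mu>)"
    by (rule ennreal_leI)
  also have "\<dots> = (\<integral>\<^sup>+\<xi>. ennreal \<bar>gA A (ray_sum h \<xi>) - gA A (ray_sum h' \<xi>)\<bar> \<partial>\<mu>)"
    by (intro nn_integral_eq_integral[symmetric]) (auto intro!: integrable_gA_ray)
  also have "\<dots> \<le> (\<integral>\<^sup>+\<xi>. ennreal (real r) * (\<Sum>k. ennreal \<bar>h (prefix_of \<xi> (Suc k)) - h' (prefix_of \<xi> (Suc k))\<bar>) \<partial>\<mu>)"
  proof (rule nn_integral_mono_AE)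
    show "AE \<xi> in \<mu>. ennreal \<bar>gA A (ray_sum h \<xi>) - gA A (ray_sum h' \<xi>)\<bar>
        \<le> ennreal (real r) * (\<Sum>k. ennreal \<bar>h (prefix_of \<xi> (Suc k)) - h' (prefix_of \<xi> (Suc k))\<bar>)"
      using AE_ray_summable[OF assms(1)] AE_ray_summable[OF assms(2)]
    proof eventually_elim
      case (elim \<xi>)
      let ?d = "\<lambda>k. h (prefix_of \<xi> (Suc k)) - h' (prefix_of \<xi> (Suc k))"
      have sd: "summable (\<lambda>k. \<bar>?d k\<bar>)"
        by (rule summable_comparison_test'[OF summable_add[OF elim], of 0]) auto
      \<comment> \<open>\<open>suminf\<close> is subtracted termwise only for summable series, hence
        the restriction to almost every ray.\<close>
      have "ray_sum h \<xi> - ray_sum h' \<xi> = (\<Sum>k. ?d k)"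
        unfolding ray_sum_def by (rule suminf_diff[OF elim[THEN summable_rabs_cancel]])
      then have "\<bar>ray_sum h \<xi> - ray_sum h' \<xi>\<bar> \<le> (\<Sum>k. \<bar>?d k\<bar>)"
        using summable_rabs[OF sd] by simp
      then have "\<bar>gA A (ray_sum h \<xi>) - gA A (ray_sum h' \<xi>)\<bar> \<le> real r * (\<Sum>k. \<bar>?d k\<bar>)"
        by (intro order_trans[OF gA_lipschitz] mult_left_mono) auto
      then have "ennreal \<bar>gA A (ray_sum h \<xi>) - gA A (ray_sum h' \<xi>)\<bar> \<le> ennreal (real r * (\<Sum>k. \<bar>?d k\<bar>))"
        by (rule ennreal_leI)
      also have "\<dots> = ennreal (real r) * ennreal (\<Sum>k. \<bar>?d k\<bar>)"
        by (rule ennreal_mult) (simp_all add: suminf_nonneg[OF sd])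
      also have "ennreal (\<Sum>k. \<bar>?d k\<bar>) = (\<Sum>k. ennreal \<bar>?d k\<bar>)"
        by (rule suminf_ennreal2[OF _ sd, symmetric]) simp
      finally show ?case .
    qed
  qed
  also have "\<dots> = ennreal (real r) * field_norm b (\<lambda>v. h v - h' v)"
    by (subst nn_integral_cmult) (auto simp: nn_integral_ray[of "\<lambda>v. h v - h' v"])
  finally show ?thesis .
qed

text \<open>The range of \<open>gA A\<close> is an interval. A number outside it lies strictly on
  one side of all values, whereas \<open>Psi\<close> is an average of values and strict inequalities
  survive integration.\<close>

lemma Psi_in_DA: "Psi b A h \<in> DA A"
proof (rule ccontr)
  assume no: "Psi b A h \<notin> DA A"
  let ?p = "Psi b A h"
  have conn: "connected (range (gA A))"
    using gA_has_derivative by (intro connected_continuous_image DERIV_continuous_on) auto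
  have "(\<forall>x. gA A x < ?p) \<or> (\<forall>x. ?p < gA A x)"
  proof (rule ccontr)
    assume "\<not> ?thesis"
    then obtain x y where "?p \<le> gA A x" "gA A y \<le> ?p" by (auto simp: not_less)
    then have "?p \<in> range (gA A)"
      using connectedD_interval[OF conn, of "gA A y" "gA A x" ?p] by auto
    with no show False by (simp add: DA_def)
  qed
  then show False
  proof
    assume "\<forall>x. gA A x < ?p"
    then have "(\<integral>\<xi>. gA A (ray_sum h \<xi>) \<partial>\<mu>) < (\<integral>\<xi>. ?p \<partial>\<mu>)"
      by (intro mu.integral_less_AE_space integrable_gA_ray) (auto simp: mu.emeasure_space_1)
    then show False by (simp add: Psi_def mu.prob_space)
  next
    assume "\<forall>x. ?p < gA A x"
    then have "(\<integral>\<xi>. ?p \<partial>\<mu>) < (\<integral>\<xi>. gA A (ray_sum h \<xi>) \<partial>\<mu>)"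
      by (intro mu.integral_less_AE_space integrable_gA_ray) (auto simp: mu.emeasure_space_1)
    then show False by (simp add: Psi_def mu.prob_space)
  qed
qed

end

section \<open>Compactness of energy sublevel sets\<close>

text \<open>Reduces the extended infinite sum to real finite sums, which pass to pointwise limits
  and scale easily.\<close>

lemma cost_le_iff:
  assumes "lam > 0" "0 \<le> C"
  shows "cost b \<alpha> lam h \<le> ennreal C \<longleftrightarrow>
    (\<forall>F. finite F \<longrightarrow> F \<subseteq> tree b - {[]} \<longrightarrow> lam * (\<Sum>v\<in>F. \<bar>h v\<bar> powr \<alpha>) \<le> C)"
proof -
  have "cost b \<alpha> lam h = (SUP F\<in>{F. finite F \<and> F \<subseteq> tree b - {[]}}. ennreal lam * (\<Sum>v\<in>F. ennreal (\<bar>h v\<bar> powr \<alpha>)))"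
    unfolding cost_def by (subst nonneg_infsum_complete) (auto intro!: SUP_mult_left_ennreal)
  also have "\<dots> = (SUP F\<in>{F. finite F \<and> F \<subseteq> tree b - {[]}}. ennreal (lam * (\<Sum>v\<in>F. \<bar>h v\<bar> powr \<alpha>)))"
    using assms by (intro SUP_cong refl) (simp add: sum_nonneg ennreal_mult)
  finally show ?thesis
    using assms by (auto simp: SUP_le_iff)
qed

text \<open>Above the threshold \<open>t\<close>, one writes \<open>\<bar>x\<bar>\<close> as a
  product of powers with exponents \<open>\<alpha>\<close> and \<open>1 - \<alpha>\<close>; the
  second power decreases because its exponent is not positive.\<close>

lemma powr_split_bound:
  fixes t x \<alpha> :: real
  assumes "0 < t" "1 \<le> \<alpha>"
  shows "\<bar>x\<bar> \<le> t + \<bar>x\<bar> powr \<alpha> * t powr (1 - \<alpha>)"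
proof (cases "\<bar>x\<bar> \<le> t")
  case True
  then show ?thesis by (simp add: add_increasing2)
next
  case False
  then have "\<bar>x\<bar> = \<bar>x\<bar> powr \<alpha> * \<bar>x\<bar> powr (1 - \<alpha>)"
    using assms by (simp flip: powr_add)
  also have "\<dots> \<le> \<bar>x\<bar> powr \<alpha> * t powr (1 - \<alpha>)"
    using False assms by (intro mult_left_mono powr_mono2') auto
  finally show ?thesis using assms by linarith
qed

text \<open>For \<open>\<alpha> \<ge> 1\<close> the threshold \<open>b powr (- k / \<alpha>)\<close> balances both terms of
  \<open>powr_split_bound\<close> on level \<open>k\<close>.\<close>

lemma level_avg_summable_bound:
  assumes "b \<ge> 2" "\<alpha> > 0" "0 \<le> S"
  shows "\<exists>B. summable B \<and>
    (\<forall>h. (\<forall>F. finite F \<longrightarrow> F \<subseteq> tree b - {[]} \<longrightarrow> (\<Sum>v\<in>F. \<bar>h v\<bar> powr \<alpha>) \<le> S)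
      \<longrightarrow> (\<forall>k. level_avg b (Suc k) h \<le> B k))"
proof (cases "\<alpha> \<ge> 1")
  case True
  define \<rho> where "\<rho> = real b powr (- 1 / \<alpha>)"
  have \<rho>: "0 < \<rho>" "\<rho> < 1"
    using assms by (auto simp: \<rho>_def powr_less_one)
  have \<rho>_pow: "\<rho> powr (- \<alpha>) = real b"
    using assms by (simp add: \<rho>_def powr_powr)
  show ?thesis
  proof (intro exI[of _ "\<lambda>k. \<rho> ^ Suc k * (1 + S)"] conjI allI impI)
    show "summable (\<lambda>k. \<rho> ^ Suc k * (1 + S))"
      using \<rho> by (intro summable_mult2 summable_Suc_iff[THEN iffD2] summable_geometric) auto
    fix h k
    assume h: "\<forall>F. finite F \<longrightarrow> F \<subseteq> tree b - {[]} \<longrightarrow> (\<Sum>v\<in>F. \<bar>h v\<bar> powr \<alpha>) \<le> S"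
    define t where "t = \<rho> ^ Suc k"
    have t: "0 < t" using \<rho> by (simp add: t_def)
    \<comment> \<open>The choice of \<open>\<rho>\<close> makes \<open>t powr (- \<alpha>)\<close>
      the number of vertices on the level, so after averaging both terms are multiples of
      \<open>t\<close>.\<close>
    have "t powr (1 - \<alpha>) = t * (\<rho> powr (- \<alpha>)) ^ Suc k"
      using \<rho> t by (simp add: t_def powr_diff powr_minus field_simps flip: powr_realpow powr_powr)
        (simp add: powr_powr powr_add powr_mult mult.commute)
    then have t_powr: "t powr (1 - \<alpha>) = t * real b ^ Suc k"
      by (simp add: \<rho>_pow)
    have "(\<Sum>v\<in>tree_level b (Suc k). \<bar>h v\<bar>)
        \<le> (\<Sum>v\<in>tree_level b (Suc k). t + \<bar>h v\<bar> powr \<alpha> * t powr (1 - \<alpha>))"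
      by (intro sum_mono powr_split_bound t True)
    also have "\<dots> = real b ^ Suc k * t + (\<Sum>v\<in>tree_level b (Suc k). \<bar>h v\<bar> powr \<alpha>) * (t * real b ^ Suc k)"
      by (simp add: sum.distrib card_tree_level t_powr sum_distrib_right)
    also have "\<dots> \<le> real b ^ Suc k * t + S * (t * real b ^ Suc k)"
      using t by (intro add_left_mono mult_right_mono h[rule_format] tree_level_subset) auto
    finally show "level_avg b (Suc k) h \<le> \<rho> ^ Suc k * (1 + S)"
      using assms unfolding level_avg_def t_def[symmetric] by (simp add: field_simps)
  qed
next
  case False
  \<comment> \<open>For \<open>\<alpha> < 1\<close>, \<open>D\<close> bounds every single value of
    the field. Trading the power \<open>1 - \<alpha>\<close> for this bound controls the whole level
    sum by a constant, and averaging supplies the geometric factor.\<close>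
  define D where "D = S powr (1 / \<alpha>)"
  show ?thesis
  proof (intro exI[of _ "\<lambda>k. (1 / real b) ^ Suc k * (S * D powr (1 - \<alpha>))"] conjI allI impI)
    show "summable (\<lambda>k. (1 / real b) ^ Suc k * (S * D powr (1 - \<alpha>)))"
      using assms by (intro summable_mult2 summable_Suc_iff[THEN iffD2] summable_geometric) auto
    fix h k
    assume h: "\<forall>F. finite F \<longrightarrow> F \<subseteq> tree b - {[]} \<longrightarrow> (\<Sum>v\<in>F. \<bar>h v\<bar> powr \<alpha>) \<le> S"
    have "(\<Sum>v\<in>tree_level b (Suc k). \<bar>h v\<bar>) \<le> (\<Sum>v\<in>tree_level b (Suc k). \<bar>h v\<bar> powr \<alpha> * D powr (1 - \<alpha>))"
    proof (rule sum_mono)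
      fix v assume "v \<in> tree_level b (Suc k)"
      then have "\<bar>h v\<bar> powr \<alpha> \<le> S"
        using h[rule_format, of "{v}"] tree_level_subset[of b k] by auto
      then have "(\<bar>h v\<bar> powr \<alpha>) powr (1 / \<alpha>) \<le> D"
        unfolding D_def using assms by (intro powr_mono2) auto
      then have "\<bar>h v\<bar> \<le> D"
        using assms by (simp add: powr_powr)
      then have "\<bar>h v\<bar> powr \<alpha> * \<bar>h v\<bar> powr (1 - \<alpha>) \<le> \<bar>h v\<bar> powr \<alpha> * D powr (1 - \<alpha>)"
        using False by (intro mult_left_mono powr_mono2) auto
      then show "\<bar>h v\<bar> \<le> \<bar>h v\<bar> powr \<alpha> * D powr (1 - \<alpha>)"
        by (simp flip: powr_add)
    qed
    also have "\<dots> \<le> S * D powr (1 - \<alpha>)"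
      unfolding sum_distrib_right[symmetric]
      by (intro mult_right_mono h[rule_format] tree_level_subset) auto
    finally show "level_avg b (Suc k) h \<le> (1 / real b) ^ Suc k * (S * D powr (1 - \<alpha>))"
      unfolding level_avg_def power_one_over by (intro mult_left_mono) auto
  qed
qed

locale cost_setting = field_setting +
  fixes \<alpha> lam :: real
  assumes b2: "b \<ge> 2" and \<alpha>_pos: "\<alpha> > 0" and lam_pos: "lam > 0"
begin

abbreviation "energy \<equiv> cost b \<alpha> lam"

lemma energy_sum_le:
  assumes "energy h \<le> ennreal C" "0 \<le> C" "finite F" "F \<subseteq> tree b - {[]}"
  shows "(\<Sum>v\<in>F. \<bar>h v\<bar> powr \<alpha>) \<le> C / lam"
proof -
  have "lam * (\<Sum>v\<in>F. \<bar>h v\<bar> powr \<alpha>) \<le> C"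
    using cost_le_iff[OF lam_pos assms(2)] assms by blast
  then show ?thesis using lam_pos by (simp add: pos_le_divide_eq mult.commute)
qed

lemma field_norm_bound:
  assumes "summable B" "\<And>k. level_avg b (Suc k) h \<le> B k"
  shows "field_norm b h \<le> ennreal (suminf B)"
proof -
  have "0 \<le> B k" for k using level_avg_nonneg assms(2) by (rule order_trans)
  then have "ennreal (suminf B) = (\<Sum>k. ennreal (B k))"
    using assms(1) by (intro suminf_ennreal2[symmetric]) auto
  then show ?thesis
    using assms(2) by (auto simp: field_norm_eq intro!: suminf_le ennreal_leI)
qed

text \<open>A pointwise limit along a subsequence keeps the energy bound through finite sums, and
  uniform domination of the level averages upgrades pointwise to norm convergence. Bounds varying
  with \<open>n\<close> accommodate minimizing sequences.\<close>

lemma energy_compact: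
  assumes h: "\<And>n::nat. h n \<in> fields b" "\<And>n. energy (h n) \<le> ennreal (c n)"
    and c: "\<And>n. 0 \<le> c n" "c \<longlonglongrightarrow> c0"
  shows "\<exists>g \<rho>. strict_mono (\<rho> :: nat \<Rightarrow> nat) \<and> g \<in> fields b \<and> energy g \<le> ennreal c0 \<and>
    (\<lambda>n. Psi b A (h (\<rho> n))) \<longlonglongrightarrow> Psi b A g"
proof -
  obtain C where C: "\<And>n. c n \<le> C" "0 \<le> C"
    using convergent_imp_Bseq[of c] c unfolding convergent_def Bseq_def
    by (metis abs_le_D1 less_imp_le real_norm_def)
  define S where "S = C / lam"
  have S: "0 \<le> S" using C lam_pos by (simp add: S_def)
  have hS: "(\<Sum>v\<in>F. \<bar>h n v\<bar> powr \<alpha>) \<le> S" if "finite F" "F \<subseteq> tree b - {[]}" for n F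
    unfolding S_def using h(2)[of n] C that
    by (intro energy_sum_le) (auto intro: order_trans ennreal_leI)
  have bound: "norm (h n v) \<le> S powr (1 / \<alpha>)" if "v \<in> tree b" for n v
  proof (cases "v = []")
    case True
    then show ?thesis using h(1)[of n] by (simp add: fields_def)
  next
    case False
    then have "(\<bar>h n v\<bar> powr \<alpha>) powr (1 / \<alpha>) \<le> S powr (1 / \<alpha>)"
      using hS[of "{v}" n] that \<alpha>_pos by (intro powr_mono2) auto
    then show ?thesis using \<alpha>_pos by (simp add: powr_powr)
  qed
  \<comment> \<open>Diagonal extraction over the countable tree, possible because the energy bounds
    each vertex value uniformly in \<open>n\<close>.\<close>
  obtain \<rho> :: "nat \<Rightarrow> nat" where \<rho>: "strict_mono \<rho>"
    and conv: "\<And>v. v \<in> tree b \<Longrightarrow> \<exists>l. (\<lambda>n. h (\<rho> n) v) \<longlonglongrightarrow> l"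
    using function_convergent_subsequence[of "tree b" h "S powr (1 / \<alpha>)"] bound by auto
  \<comment> \<open>Off the tree \<open>lim\<close> may be an arbitrary value; energy, norm and
    \<open>Psi\<close> read only values on the tree.\<close>
  define g where "g v = lim (\<lambda>n. h (\<rho> n) v)" for v
  have g: "(\<lambda>n. h (\<rho> n) v) \<longlonglongrightarrow> g v" if "v \<in> tree b" for v
    using conv[OF that] limI unfolding g_def by blast
  have g_sum: "(\<lambda>n. \<Sum>v\<in>F. \<bar>h (\<rho> n) v\<bar> powr \<alpha>) \<longlonglongrightarrow> (\<Sum>v\<in>F. \<bar>g v\<bar> powr \<alpha>)"
    if "F \<subseteq> tree b" for F
    using that \<alpha>_pos by (intro tendsto_sum tendsto_powr2 tendsto_rabs g tendsto_const) auto
  have "0 \<le> c0" using c by (auto intro: LIMSEQ_le_const)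
  have energy_g: "energy g \<le> ennreal c0"
    unfolding cost_le_iff[OF lam_pos \<open>0 \<le> c0\<close>]
  proof (intro allI impI)
    fix F assume F: "finite F" "F \<subseteq> tree b - {[]}"
    show "lam * (\<Sum>v\<in>F. \<bar>g v\<bar> powr \<alpha>) \<le> c0"
    proof (rule LIMSEQ_le)
      show "(\<lambda>n. lam * (\<Sum>v\<in>F. \<bar>h (\<rho> n) v\<bar> powr \<alpha>)) \<longlonglongrightarrow> lam * (\<Sum>v\<in>F. \<bar>g v\<bar> powr \<alpha>)"
        using F by (intro tendsto_intros g_sum) auto
      show "(\<lambda>n. c (\<rho> n)) \<longlonglongrightarrow> c0"
        using LIMSEQ_subseq_LIMSEQ[OF c(2) \<rho>] by (simp add: o_def)
      show "\<exists>N. \<forall>n\<ge>N. lam * (\<Sum>v\<in>F. \<bar>h (\<rho> n) v\<bar> powr \<alpha>) \<le> c (\<rho> n)"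
        using h(2) c(1) F cost_le_iff[OF lam_pos] by blast
    qed
  qed
  have gS: "(\<Sum>v\<in>F. \<bar>g v\<bar> powr \<alpha>) \<le> S" if "finite F" "F \<subseteq> tree b - {[]}" for F
  proof (rule LIMSEQ_le_const2[OF g_sum])
    show "\<exists>N. \<forall>n\<ge>N. (\<Sum>v\<in>F. \<bar>h (\<rho> n) v\<bar> powr \<alpha>) \<le> S"
      using hS[OF that] by auto
  qed (use that in auto)
  \<comment> \<open>\<open>B\<close> depends on the energy bound alone and so dominates the level
    averages of all \<open>h n\<close> and of \<open>g\<close> at once.\<close>
  obtain B where B: "summable B"
    and B_all: "\<forall>h. (\<forall>F. finite F \<longrightarrow> F \<subseteq> tree b - {[]} \<longrightarrow> (\<Sum>v\<in>F. \<bar>h v\<bar> powr \<alpha>) \<le> S)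
      \<longrightarrow> (\<forall>k. level_avg b (Suc k) h \<le> B k)"
    using level_avg_summable_bound[OF b2 \<alpha>_pos S] by auto
  have gB: "level_avg b (Suc k) g \<le> B k" for k
    using B_all gS by blast
  have hB: "level_avg b (Suc k) (h n) \<le> B k" for n k
    using B_all hS by blast
  have norm_g: "field_norm b g < \<infinity>"
    using field_norm_bound[OF B gB] by (auto intro: le_less_trans)
  have "g [] = 0"
    using g[of "[]"] h(1) by (simp add: fields_def tree_def tendsto_const_iff)
  with norm_g have g_fields: "g \<in> fields b" by (simp add: fields_def)
  define d where "d n k = level_avg b (Suc k) (\<lambda>v. h (\<rho> n) v - g v)" for n k
  have d0: "(\<lambda>n. d n k) \<longlonglongrightarrow> 0" for k
  proof -
    have "(\<lambda>n. d n k) \<longlonglongrightarrow> (1 / real b ^ Suc k) * (\<Sum>v\<in>tree_level b (Suc k). \<bar>g v - g v\<bar>)"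
      unfolding d_def level_avg_def
      using tree_level_subset by (intro tendsto_intros tendsto_sum g) auto
    then show ?thesis by simp
  qed
  have dB: "norm (d n k) \<le> 2 * B k" for n k
  proof -
    have "d n k \<le> level_avg b (Suc k) (h (\<rho> n)) + level_avg b (Suc k) g"
      unfolding d_def level_avg_def distrib_left[symmetric] sum.distrib[symmetric]
      by (intro mult_left_mono sum_mono) auto
    also have "\<dots> \<le> B k + B k"
      by (intro add_mono hB gB)
    finally show ?thesis by (simp add: d_def level_avg_nonneg)
  qed
  have B2: "summable (\<lambda>k. 2 * B k)" using B by (rule summable_mult)
  \<comment> \<open>Dominated convergence for series, with dominating terms
    \<open>2 * B k\<close>.\<close>
  have "(\<lambda>n. \<Sum>k. d n k) \<longlonglongrightarrow> suminf (\<lambda>k. 0)"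
    using dB by (intro tannerys_theorem[OF d0 _ B2, THEN conjunct2, THEN conjunct2] always_eventually) auto
  then have lim0: "(\<lambda>n. real r * (\<Sum>k. d n k)) \<longlonglongrightarrow> 0"
    by (auto intro: tendsto_mult_right_zero)
  have Psi_le: "\<bar>Psi b A (h (\<rho> n)) - Psi b A g\<bar> \<le> real r * (\<Sum>k. d n k)" for n
  proof -
    have sd: "summable (d n)"
      by (rule summable_comparison_test'[OF B2 dB])
    have d_nonneg: "0 \<le> d n k" for k by (simp add: d_def level_avg_nonneg)
    have "ennreal \<bar>Psi b A (h (\<rho> n)) - Psi b A g\<bar> \<le> ennreal (real r) * (\<Sum>k. ennreal (d n k))"
      using Psi_lipschitz[of "h (\<rho> n)" g] h(1)[of "\<rho> n"] norm_g
      by (auto simp: fields_def field_norm_eq d_def)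
    also have "\<dots> = ennreal (real r * (\<Sum>k. d n k))"
      using sd d_nonneg by (simp add: suminf_ennreal2 ennreal_mult suminf_nonneg)
    finally show ?thesis
      using sd d_nonneg by (simp add: suminf_nonneg)
  qed
  have "(\<lambda>n. Psi b A (h (\<rho> n)) - Psi b A g) \<longlonglongrightarrow> 0"
    by (rule Lim_null_comparison[OF always_eventually lim0]) (simp add: Psi_le)
  then have "(\<lambda>n. Psi b A (h (\<rho> n))) \<longlonglongrightarrow> Psi b A g"
    by (simp add: LIM_zero_iff)
  then show ?thesis using \<rho> g_fields energy_g by blast
qed

end

section \<open>The rate function\<close>

context cost_setting
begin

abbreviation "Q \<equiv> QA b \<alpha> lam A"
abbreviation "\<nu>A \<equiv> measure gauss A"

lemma gA_0: "gA A 0 = \<nu>A"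
  by (simp add: gA_def)

lemma Q_le_energy: "h \<in> fields b \<Longrightarrow> Q (Psi b A h) \<le> energy h"
  unfolding QA_def by (intro Inf_lower) auto

text \<open>Compactness is applied to a minimizing sequence along which \<open>Psi\<close> is
  constantly \<open>q\<close>; the limit field then has the same \<open>Psi\<close> and at most the
  infimal energy.\<close>

lemma Q_attained:
  assumes "Q q < \<infinity>"
  obtains h where "h \<in> fields b" "Psi b A h = q" "energy h = Q q"
proof -
  obtain c where c: "Q q = ennreal c" "0 \<le> c"
    using assms by (metis ennreal_cases infinity_ennreal_def order_less_irrefl)
  \<comment> \<open>The positive slack puts \<open>cn n\<close> strictly above the infimum, so some
    admissible field lies below it.\<close>
  define cn where "cn n = c + inverse (real (Suc n))" for n
  have "\<exists>h. h \<in> fields b \<and> Psi b A h = q \<and> energy h \<le> ennreal (cn n)" for n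
  proof -
    have "Q q < ennreal (cn n)"
      using c by (auto simp: cn_def intro!: ennreal_lessI add_nonneg_pos)
    then show ?thesis
      unfolding QA_def Inf_less_iff using less_imp_le by blast
  qed
  then obtain h where h: "\<And>n. h n \<in> fields b" "\<And>n. Psi b A (h n) = q" "\<And>n. energy (h n) \<le> ennreal (cn n)"
    by metis
  have cn: "cn \<longlonglongrightarrow> c"
    using tendsto_add[OF tendsto_const[of c] LIMSEQ_inverse_real_of_nat] by (simp add: cn_def[abs_def])
  have cn_nonneg: "0 \<le> cn n" for n
    using c by (simp add: cn_def)
  obtain g \<rho> where "strict_mono (\<rho> :: nat \<Rightarrow> nat)" and g: "g \<in> fields b" "energy g \<le> ennreal c"
    "(\<lambda>n. Psi b A (h (\<rho> n))) \<longlonglongrightarrow> Psi b A g"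
    using energy_compact[OF h(1,3) cn_nonneg cn] by auto
  then have "Psi b A g = q"
    using h(2) by (simp add: LIMSEQ_const_iff)
  with g have "energy g = Q q"
    using Q_le_energy[OF g(1)] c by (intro antisym) auto
  with g \<open>Psi b A g = q\<close> that show thesis by blast
qed

text \<open>Optimal fields for the \<open>q n\<close> share one energy bound, so a subsequential
  limit is admissible for \<open>q0\<close>. An infinite \<open>c\<close> is trivial.\<close>

lemma Q_closed:
  assumes "\<And>n. Q (q n) \<le> c" "q \<longlonglongrightarrow> q0"
  shows "Q q0 \<le> c"
proof (cases c)
  case (real C)
  then have "0 \<le> C" by simp
  have "\<exists>h. h \<in> fields b \<and> Psi b A h = q n \<and> energy h \<le> ennreal C" for n
  proof -
    have "Q (q n) < \<infinity>"
      using assms(1)[of n] real by (auto intro: le_less_trans)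
    then show ?thesis
      using Q_attained[of "q n"] assms(1)[of n] real by metis
  qed
  then obtain h where h: "\<And>n. h n \<in> fields b" "\<And>n. Psi b A (h n) = q n" "\<And>n. energy (h n) \<le> ennreal C"
    by metis
  obtain g \<rho> where \<rho>: "strict_mono (\<rho> :: nat \<Rightarrow> nat)" and g: "g \<in> fields b" "energy g \<le> ennreal C"
    "(\<lambda>n. Psi b A (h (\<rho> n))) \<longlonglongrightarrow> Psi b A g"
    using energy_compact[of h "\<lambda>_. C" C, OF h(1,3) \<open>0 \<le> C\<close> tendsto_const] by auto
  have "(\<lambda>n. Psi b A (h (\<rho> n))) \<longlonglongrightarrow> q0"
    using LIMSEQ_subseq_LIMSEQ[OF assms(2) \<rho>] by (simp add: h(2) o_def)
  then have "Psi b A g = q0"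
    using g(3) LIMSEQ_unique by blast
  then show ?thesis
    using Q_le_energy[OF g(1)] g(2) real by auto
qed simp

lemma lower_semicontinuous_Q: "lower_semicontinuous_on S Q"
  unfolding lower_semicontinuous_on_def
proof (intro ballI allI impI)
  fix x c assume "c < Q x"
  show "\<forall>\<^sub>F y in at x within S. c < Q y"
  proof (rule ccontr)
    assume "\<not> ?thesis"
    then have "\<exists>\<^sub>F y in at x within S. Q y \<le> c"
      by (simp add: frequently_def not_le)
    then have "\<exists>y. Q y \<le> c \<and> dist y x < d" if "0 < d" for d
      using that unfolding frequently_at by blast
    then have "\<exists>y. Q y \<le> c \<and> dist y x < inverse (real (Suc n))" for n
      by simp
    then obtain y where y: "\<And>n. Q (y n) \<le> c" "\<And>n. dist (y n) x < inverse (real (Suc n))"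
      by metis
    have "y \<longlonglongrightarrow> x"
      by (subst tendsto_dist_iff, rule Lim_null_comparison[OF always_eventually LIMSEQ_inverse_real_of_nat])
        (simp add: less_imp_le[OF y(2)] del: of_nat_Suc)
    then have "Q x \<le> c" using Q_closed y(1) by blast
    with \<open>c < Q x\<close> show False by simp
  qed
qed

text \<open>The test field takes the value \<open>x\<close> on the \<open>b\<close> vertices of the
  first level and 0 elsewhere, so every ray sums to \<open>x\<close>.\<close>

lemma Q_gA_le: "Q (gA A x) \<le> ennreal (lam * (real b * \<bar>x\<bar> powr \<alpha>))"
proof -
  define h :: "nat list \<Rightarrow> real" where "h v = (if length v = 1 then x else 0)" for v
  have energy: "energy h \<le> ennreal (lam * (real b * \<bar>x\<bar> powr \<alpha>))"
  proof (rule cost_le_iff[OF lam_pos, THEN iffD2], goal_cases)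
    case 2
    show ?case
    proof (intro allI impI mult_left_mono)
      fix F assume F: "finite F" "F \<subseteq> tree b - {[]}"
      have "(\<Sum>v\<in>F. \<bar>h v\<bar> powr \<alpha>) = (\<Sum>v\<in>F \<inter> tree_level b 1. \<bar>x\<bar> powr \<alpha>)"
        using F by (intro sum.mono_neutral_cong_right) (auto simp: h_def tree_level_def)
      also have "\<dots> \<le> (\<Sum>v\<in>tree_level b 1. \<bar>x\<bar> powr \<alpha>)"
        by (intro sum_mono2) auto
      finally show "(\<Sum>v\<in>F. \<bar>h v\<bar> powr \<alpha>) \<le> real b * \<bar>x\<bar> powr \<alpha>"
        by (simp add: card_tree_level)
    qed (use lam_pos in auto)
  qed (use lam_pos in auto)
  have avg: "level_avg b (Suc k) h = (if k = 0 then \<bar>x\<bar> else 0)" for k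
    using b2 card_tree_level[of b 1] by (auto simp: level_avg_def h_def tree_level_def)
  have "field_norm b h < \<infinity>"
    unfolding field_norm_eq avg by (subst suminf_finite[of "{0}"]) auto
  then have "h \<in> fields b"
    by (simp add: fields_def h_def)
  moreover have "ray_sum h \<xi> = x" for \<xi>
    unfolding ray_sum_def by (subst suminf_finite[of "{0}"]) (auto simp: h_def prefix_of_def)
  then have "Psi b A h = gA A x"
    by (simp add: Psi_def mu.prob_space)
  ultimately show ?thesis
    using Q_le_energy[of h] energy by auto
qed

lemma Q_finite_iff: "Q q < \<infinity> \<longleftrightarrow> q \<in> DA A"
proof
  assume "Q q < \<infinity>"
  then show "q \<in> DA A" using Q_attained Psi_in_DA by metis
next
  assume "q \<in> DA A"
  then obtain x where "q = gA A x" by (auto simp: DA_def)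
  then show "Q q < \<infinity>" using Q_gA_le[of x] by (auto intro: le_less_trans)
qed

section \<open>Scaling of fields and monotonicity\<close>

lemma energy_scale:
  assumes "energy h \<le> ennreal C" "0 \<le> C" "0 \<le> t"
  shows "energy (\<lambda>v. t * h v) \<le> ennreal (t powr \<alpha> * C)"
proof -
  have eq: "lam * (\<Sum>v\<in>F. \<bar>t * h v\<bar> powr \<alpha>) = t powr \<alpha> * (lam * (\<Sum>v\<in>F. \<bar>h v\<bar> powr \<alpha>))" for F
    using assms(3) by (simp add: abs_mult powr_mult sum_distrib_left mult.left_commute)
  have "lam * (\<Sum>v\<in>F. \<bar>h v\<bar> powr \<alpha>) \<le> C" if "finite F" "F \<subseteq> tree b - {[]}" for F
    using assms that cost_le_iff[OF lam_pos assms(2)] by blast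
  then show ?thesis
    using assms(2,3) unfolding cost_le_iff[OF lam_pos mult_nonneg_nonneg[OF powr_ge_zero assms(2)]] eq
    by (intro allI impI mult_left_mono) auto
qed

lemma field_norm_scale: "field_norm b (\<lambda>v. t * h v) = ennreal \<bar>t\<bar> * field_norm b h"
proof -
  have "level_avg b k (\<lambda>v. t * h v) = \<bar>t\<bar> * level_avg b k h" for k
    by (simp add: level_avg_def abs_mult sum_distrib_left mult.left_commute)
  then show ?thesis
    by (simp add: field_norm_eq ennreal_mult level_avg_nonneg)
qed

lemma scale_fields: "h \<in> fields b \<Longrightarrow> (\<lambda>v. t * h v) \<in> fields b"
  by (auto simp: fields_def field_norm_scale ennreal_mult_less_top)

text \<open>Along the segment through \<open>h\<close> the norm distance is
  \<open>\<bar>s - t\<bar>\<close> times the finite norm of \<open>h\<close>, so \<open>Psi\<close>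
  is Lipschitz in the scaling factor.\<close>

lemma continuous_Psi_scale:
  assumes "h \<in> fields b"
  shows "continuous_on UNIV (\<lambda>t. Psi b A (\<lambda>v. t * h v))"
proof -
  obtain N where N: "field_norm b h = ennreal N" "0 \<le> N"
    using assms by (auto simp: fields_def less_top_ennreal)
  have "\<bar>Psi b A (\<lambda>v. s * h v) - Psi b A (\<lambda>v. t * h v)\<bar> \<le> (real r * N) * \<bar>s - t\<bar>" for s t
  proof -
    have "field_norm b (\<lambda>v. s * h v - t * h v) = ennreal (\<bar>s - t\<bar> * N)"
      unfolding left_diff_distrib[symmetric] using N by (simp add: field_norm_scale ennreal_mult)
    moreover have "field_norm b (\<lambda>v. s * h v) < \<infinity>" "field_norm b (\<lambda>v. t * h v) < \<infinity>"
      using scale_fields[OF assms] by (simp_all add: fields_def)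
    ultimately have "ennreal \<bar>Psi b A (\<lambda>v. s * h v) - Psi b A (\<lambda>v. t * h v)\<bar> \<le> ennreal (real r * (\<bar>s - t\<bar> * N))"
      using Psi_lipschitz N by (simp add: ennreal_mult) metis
    then show ?thesis using N by (simp add: ac_simps)
  qed
  then have "(real r * N)-lipschitz_on UNIV (\<lambda>t. Psi b A (\<lambda>v. t * h v))"
    using N by (intro lipschitz_onI) (auto simp: dist_real_def)
  then show ?thesis by (rule lipschitz_on_continuous_on)
qed

lemma Psi_0: "Psi b A (\<lambda>v. 0) = \<nu>A"
  by (simp add: Psi_def ray_sum_def gA_0 mu.prob_space)

text \<open>Attainment is what makes the forward direction work: a field of zero energy, not merely
  of small energy, vanishes on the tree.\<close>

lemma Q_zero_iff: "Q q = 0 \<longleftrightarrow> q = \<nu>A"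
proof
  assume "Q q = 0"
  then obtain h where h: "h \<in> fields b" "Psi b A h = q" "energy h \<le> ennreal 0"
    using Q_attained[of q] by (metis ennreal_0 ennreal_zero_less_top infinity_ennreal_def order_refl)
  have h0: "h v = 0" if "v \<in> tree b" for v
  proof (cases "v = []")
    case False
    then have "\<bar>h v\<bar> powr \<alpha> \<le> 0"
      using energy_sum_le[OF h(3), of "{v}"] that by simp
    then show ?thesis by simp
  qed (use h in \<open>simp add: fields_def\<close>)
  have "ray_sum h \<xi> = 0" if "\<xi> \<in> space \<mu>" for \<xi>
    using h0 prefix_in_level[OF that] by (simp add: ray_sum_def tree_level_def)
  then have "Psi b A h = Psi b A (\<lambda>v. 0)"
    unfolding Psi_def by (intro Bochner_Integration.integral_cong refl) (simp add: ray_sum_def)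
  with h Psi_0 show "q = \<nu>A" by simp
next
  assume "q = \<nu>A"
  then show "Q q = 0" using Q_gA_le[of 0] gA_0 \<alpha>_pos by simp
qed

text \<open>Scaling an optimal field down to \<open>0\<close> moves \<open>Psi\<close> continuously from \<open>q\<close> to \<open>\<nu>A\<close>
  and strictly lowers its energy.\<close>

lemma Q_strict:
  assumes "Q q < \<infinity>" and between: "q < q' \<and> q' \<le> \<nu>A \<or> \<nu>A \<le> q' \<and> q' < q"
  shows "Q q' < Q q"
proof -
  obtain h where h: "h \<in> fields b" "Psi b A h = q" "energy h = Q q"
    using assms(1) by (rule Q_attained)
  obtain c where c: "Q q = ennreal c" "0 \<le> c"
    using assms by (metis ennreal_cases infinity_ennreal_def order_less_irrefl)
  have "q \<noteq> \<nu>A" using between by auto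
  \<comment> \<open>Positive minimal energy is needed for multiplication by a factor below 1 to
    lower it strictly.\<close>
  then have "0 < c" using Q_zero_iff[of q] c by (cases "c = 0") auto
  let ?p = "\<lambda>t. Psi b A (\<lambda>v. t * h v)"
  define S where "S = ?p ` {0..1}"
  have "connected S"
    unfolding S_def
    using continuous_Psi_scale[OF h(1)] continuous_on_subset
    by (intro connected_continuous_image) auto
  moreover have "\<nu>A \<in> S" "q \<in> S"
    \<comment> \<open>The factors 0 and 1 give the two ends; connectedness then provides a factor
      \<open>t\<close> for \<open>q'\<close>.\<close>
    unfolding S_def using Psi_0 h(2) by (auto intro: image_eqI[of _ _ 0] image_eqI[of _ _ 1])
  ultimately have "q' \<in> S"
    using between connectedD_interval[of S q \<nu>A q'] connectedD_interval[of S \<nu>A q q'] by linarith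
  then obtain t where t: "0 \<le> t" "t \<le> 1" "?p t = q'" by (auto simp: S_def)
  have "t \<noteq> 1" using t(3) h(2) between by auto
  then have "t powr \<alpha> < 1"
    using t \<alpha>_pos powr_less_mono2[of \<alpha> t 1] by simp
  then have "ennreal (t powr \<alpha> * c) < ennreal c"
    using \<open>0 < c\<close> by (intro ennreal_lessI) auto
  moreover have "Q q' \<le> ennreal (t powr \<alpha> * c)"
    using Q_le_energy[OF scale_fields[OF h(1)], of t] energy_scale[of h c t] h(3) c t by auto
  ultimately show ?thesis using c by auto
qed

text \<open>Extends monotonicity to arguments where the rate is infinite, so that it holds on whole
  intervals and not only on \<open>DA A\<close>.\<close>

lemma Q_mono_weak:
  assumes "q \<le> q' \<and> q' \<le> \<nu>A \<or> \<nu>A \<le> q' \<and> q' \<le> q"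
  shows "Q q' \<le> Q q"
proof (cases "Q q < \<infinity> \<and> q' \<noteq> q")
  case True
  then show ?thesis using Q_strict[of q q'] assms by auto
next
  case False
  then show ?thesis by (auto simp: less_top[symmetric])
qed

lemma Q_small_near:
  assumes "0 < c"
  obtains e where "0 < e" "\<And>x. \<bar>x\<bar> < e \<Longrightarrow> Q (gA A x) \<le> ennreal c"
proof -
  have "((\<lambda>x. lam * (real b * \<bar>x\<bar> powr \<alpha>)) \<longlongrightarrow> lam * (real b * \<bar>0\<bar> powr \<alpha>)) (at (0::real))"
    using \<alpha>_pos by (intro tendsto_intros tendsto_powr2) auto
  then have "\<forall>\<^sub>F x in at 0. lam * (real b * \<bar>x\<bar> powr \<alpha>) < c"
    using assms \<alpha>_pos by (intro order_tendstoD) auto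
  then obtain e where e: "0 < e" "\<And>x. x \<noteq> 0 \<Longrightarrow> dist x 0 < e \<Longrightarrow> lam * (real b * \<bar>x\<bar> powr \<alpha>) < c"
    unfolding eventually_at by auto
  have "Q (gA A x) \<le> ennreal c" if "\<bar>x\<bar> < e" for x
  proof (cases "x = 0")
    case True
    then show ?thesis using Q_zero_iff[of "gA A x"] gA_0 by simp
  next
    case False
    then show ?thesis
      using e(2)[of x] that by (intro order_trans[OF Q_gA_le] ennreal_leI) auto
  qed
  with e(1) that show thesis by blast
qed

end

section \<open>Monotone functions with extended values\<close>

text \<open>The limit is given explicitly, because its comparison with the value decides whether
  there is a jump.\<close>

lemma antimono_tendsto_at_left:
  fixes f :: "real \<Rightarrow> ennreal"
  assumes anti: "antimono_on {a..p} f" and q: "a < q" "q \<le> p"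
  shows "(f \<longlongrightarrow> (INF y\<in>{a..<q}. f y)) (at_left q)"
proof (rule order_tendstoI)
  fix c assume c: "c < (INF y\<in>{a..<q}. f y)"
  have "\<forall>\<^sub>F y in at_left q. y \<in> {a<..<q}"
    using q by (intro eventually_at_leftI) auto
  then show "\<forall>\<^sub>F y in at_left q. c < f y"
    by eventually_elim (use c in \<open>auto intro: less_INF_D\<close>)
next
  fix c assume "(INF y\<in>{a..<q}. f y) < c"
  then obtain z where z: "a \<le> z" "z < q" "f z < c"
    by (auto simp: INF_less_iff)
  have "\<forall>\<^sub>F y in at_left q. y \<in> {z<..<q}"
    using z by (intro eventually_at_leftI) auto
  then show "\<forall>\<^sub>F y in at_left q. f y < c"
  proof eventually_elim
    case (elim y)
    then have "f y \<le> f z"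
      using z q by (intro monotone_onD[OF anti]) auto
    with z show ?case by simp
  qed
qed

lemma antimono_tendsto_at_right:
  fixes f :: "real \<Rightarrow> ennreal"
  assumes anti: "antimono_on {a..p} f" and q: "a \<le> q" "q < p"
  shows "(f \<longlongrightarrow> (SUP y\<in>{q<..p}. f y)) (at_right q)"
proof (rule order_tendstoI)
  fix c assume c: "(SUP y\<in>{q<..p}. f y) < c"
  have "\<forall>\<^sub>F y in at_right q. y \<in> {q<..<p}"
    using q by (intro eventually_at_rightI) auto
  then show "\<forall>\<^sub>F y in at_right q. f y < c"
    by eventually_elim (use c in \<open>auto intro: SUP_lessD\<close>)
next
  fix c assume "c < (SUP y\<in>{q<..p}. f y)"
  then obtain z where z: "q < z" "z \<le> p" "c < f z"
    by (auto simp: less_SUP_iff)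
  have "\<forall>\<^sub>F y in at_right q. y \<in> {q<..<z}"
    using z by (intro eventually_at_rightI) auto
  then show "\<forall>\<^sub>F y in at_right q. c < f y"
  proof eventually_elim
    case (elim y)
    then have "f z \<le> f y"
      using z q by (intro monotone_onD[OF anti]) auto
    with z show ?case by simp
  qed
qed

text \<open>Each jump of a monotone function contains a rational, and distinct jumps are disjoint.\<close>

lemma antimono_countable_left_discont:
  fixes f :: "real \<Rightarrow> ennreal"
  assumes anti: "antimono_on {a..p} f"
  shows "countable {q \<in> {a<..p}. \<not> (f \<longlongrightarrow> f q) (at_left q)}"
proof -
  define D where "D = {q \<in> {a<..p}. \<not> (f \<longlongrightarrow> f q) (at_left q)}"
  have "\<exists>x::rat. f q < ennreal (of_rat x) \<and> (\<forall>y\<in>{a..<q}. ennreal (of_rat x) < f y)" if "q \<in> D" for q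
  proof -
    have q: "a < q" "q \<le> p" "\<not> (f \<longlongrightarrow> f q) (at_left q)"
      using that by (auto simp: D_def)
    let ?l = "INF y\<in>{a..<q}. f y"
    have lim: "(f \<longlongrightarrow> ?l) (at_left q)"
      using q by (intro antimono_tendsto_at_left[OF anti]) auto
    have "f q \<le> ?l"
      using q by (intro INF_greatest monotone_onD[OF anti]) auto
    moreover have "f q \<noteq> ?l" using q lim by auto
    ultimately have "f q < ?l" by simp
    then obtain x where "f q < real_of_rat x" "real_of_rat x < ?l"
      using ennreal_rat_dense by blast
    then show ?thesis by (auto intro: less_INF_D)
  qed
  then have "\<forall>q\<in>D. \<exists>x::rat. f q < ennreal (of_rat x) \<and> (\<forall>y\<in>{a..<q}. ennreal (of_rat x) < f y)"
    by blast
  from bchoice[OF this] obtain x :: "real \<Rightarrow> rat" where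
    x: "\<forall>q\<in>D. f q < ennreal (of_rat (x q)) \<and> (\<forall>y\<in>{a..<q}. ennreal (of_rat (x q)) < f y)" ..
  \<comment> \<open>The value \<open>f q1\<close> lies below the rational chosen at
    \<open>q1\<close> and above the one chosen at \<open>q2\<close>.\<close>
  have "x q1 \<noteq> x q2" if "q1 \<in> D" "q2 \<in> D" "q1 < q2" for q1 q2
  proof -
    have "f q1 < ennreal (of_rat (x q1))" using x that(1) by blast
    moreover have "q1 \<in> {a..<q2}" using that by (auto simp: D_def)
    then have "ennreal (of_rat (x q2)) < f q1" using x that(2) by blast
    ultimately show ?thesis by auto
  qed
  then have "inj_on x D"
    unfolding inj_on_def by (metis linorder_neqE)
  then show ?thesis
    unfolding D_def[symmetric] by (rule countable_image_inj_on[rotated]) simp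
qed

context
  fixes f :: "real \<Rightarrow> ennreal" and p d :: real
  assumes mono: "mono_on {p..d} f"
begin

text \<open>Reflection at 0 exchanges left and right limits and carries the antitone results over to
  monotone functions.\<close>

lemma antimono_reflect: "antimono_on {-d..-p} (\<lambda>x. f (- x))"
  using mono by (auto simp: monotone_on_def)

lemma mono_tendsto_at_right:
  assumes "p \<le> q" "q < d"
  shows "\<exists>l. (f \<longlongrightarrow> l) (at_right q)"
  using antimono_tendsto_at_left[OF antimono_reflect, of "- q"] assms
  by (auto simp: filterlim_at_left_to_right)

lemma mono_tendsto_at_left:
  assumes "p < q" "q \<le> d"
  shows "(f \<longlongrightarrow> (SUP y\<in>{p..<q}. f y)) (at_left q)"
proof -
  have "(\<lambda>y. f (- y)) ` {- q<..- p} = f ` {p..<q}"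
  proof -
    have "{p..<q} = uminus ` {- q<..- p}" by simp
    then show ?thesis by (simp only: image_image)
  qed
  then show ?thesis
    using antimono_tendsto_at_right[OF antimono_reflect, of "- q"] assms
    by (simp add: filterlim_at_left_to_right)
qed

lemma mono_countable_right_discont: "countable {q \<in> {p..<d}. \<not> (f \<longlongrightarrow> f q) (at_right q)}"
proof -
  have "countable (uminus ` {q \<in> {-d<..-p}. \<not> ((\<lambda>x. f (- x)) \<longlongrightarrow> f (- q)) (at_left q)})"
    by (intro countable_image antimono_countable_left_discont antimono_reflect)
  moreover have "{q \<in> {p..<d}. \<not> (f \<longlongrightarrow> f q) (at_right q)}
      \<subseteq> uminus ` {q \<in> {-d<..-p}. \<not> ((\<lambda>x. f (- x)) \<longlongrightarrow> f (- q)) (at_left q)}"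
  proof
    fix q assume "q \<in> {q \<in> {p..<d}. \<not> (f \<longlongrightarrow> f q) (at_right q)}"
    then show "q \<in> uminus ` {q \<in> {-d<..-p}. \<not> ((\<lambda>x. f (- x)) \<longlongrightarrow> f (- q)) (at_left q)}"
      by (intro image_eqI[of _ _ "- q"]) (auto simp: filterlim_at_left_to_right)
  qed
  ultimately show ?thesis by (rule countable_subset[rotated])
qed

end

section \<open>Lower semicontinuous functions with a single valley\<close>

lemma lower_semicontinuous_frequently_le:
  assumes "lower_semicontinuous_on S f" "q \<in> S" "\<exists>\<^sub>F y in at q within S. f y \<le> c"
  shows "f q \<le> c"
  using assms unfolding lower_semicontinuous_on_def frequently_def not_le by (meson not_le)

lemma at_within_unit:
  fixes q :: real
  shows "0 < q \<Longrightarrow> q \<le> 1 \<Longrightarrow> at_left q \<le> at q within {0..1}"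
    and "0 \<le> q \<Longrightarrow> q < 1 \<Longrightarrow> at_right q \<le> at q within {0..1}"
    and "0 < q \<Longrightarrow> q < 1 \<Longrightarrow> at q within {0..1} = sup (at_left q) (at_right q)"
proof -
  show "0 < q \<Longrightarrow> q \<le> 1 \<Longrightarrow> at_left q \<le> at q within {0..1}"
    by (subst at_within_Icc_at_left[symmetric, of 0]) (auto intro: at_le)
  show "0 \<le> q \<Longrightarrow> q < 1 \<Longrightarrow> at_right q \<le> at q within {0..1}"
    by (subst at_within_Icc_at_right[symmetric, of _ 1]) (auto intro: at_le)
  show "0 < q \<Longrightarrow> q < 1 \<Longrightarrow> at q within {0..1} = sup (at_left q) (at_right q)"
    by (simp add: at_within_interior at_eq_sup_left_right)
qed

text \<open>Isolates the shape of the rate function from the tree: one-sided limits and countability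
  of discontinuities depend only on these properties.\<close>

locale valley =
  fixes f :: "real \<Rightarrow> ennreal" and p :: real
  assumes p01: "0 \<le> p" "p \<le> 1"
    and anti: "antimono_on {0..p} f" and mono: "mono_on {p..1} f"
    and lsc: "lower_semicontinuous_on {0..1} f"
begin

text \<open>Monotonicity bounds the right limit by \<open>f q\<close> from above, and lower
  semicontinuity bounds it from below.\<close>

lemma right_continuous:
  assumes "0 \<le> q" "q < p"
  shows "(f \<longlongrightarrow> f q) (at_right q)"
proof -
  let ?r = "SUP y\<in>{q<..p}. f y"
  have ev: "\<forall>\<^sub>F y in at_right q. f y \<le> ?r"
    using assms by (intro eventually_at_rightI[of _ p]) (auto intro!: SUP_upper)
  have "\<exists>\<^sub>F y in at_right q. f y \<le> ?r"
    using eventually_frequently[OF _ ev] by simp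
  then have "\<exists>\<^sub>F y in at q within {0..1}. f y \<le> ?r"
    using assms p01 at_within_unit(2)[of q] unfolding frequently_def by (auto dest: filter_leD)
  then have "f q \<le> ?r"
    using assms p01 by (intro lower_semicontinuous_frequently_le[OF lsc]) auto
  moreover have "?r \<le> f q"
    using assms by (intro SUP_least monotone_onD[OF anti]) auto
  ultimately have "f q = ?r" by (rule antisym)
  then show ?thesis
    using antimono_tendsto_at_right[OF anti, of q] assms by metis
qed

lemma left_continuous:
  assumes "p < q" "q \<le> 1"
  shows "(f \<longlongrightarrow> f q) (at_left q)"
proof -
  let ?r = "SUP y\<in>{p..<q}. f y"
  have ev: "\<forall>\<^sub>F y in at_left q. f y \<le> ?r"
    using assms by (intro eventually_at_leftI[of p]) (auto intro!: SUP_upper)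
  have "\<exists>\<^sub>F y in at_left q. f y \<le> ?r"
    using eventually_frequently[OF _ ev] by simp
  then have "\<exists>\<^sub>F y in at q within {0..1}. f y \<le> ?r"
    using assms p01 at_within_unit(1)[of q] unfolding frequently_def by (auto dest: filter_leD)
  then have "f q \<le> ?r"
    using assms p01 by (intro lower_semicontinuous_frequently_le[OF lsc]) auto
  moreover have "?r \<le> f q"
    using assms by (intro SUP_least monotone_onD[OF mono]) auto
  ultimately have "f q = ?r" by (rule antisym)
  then show ?thesis
    using mono_tendsto_at_left[OF mono, of q] assms by metis
qed

lemma left_limit: "0 < q \<Longrightarrow> q \<le> 1 \<Longrightarrow> \<exists>l. (f \<longlongrightarrow> l) (at_left q)"
  using antimono_tendsto_at_left[OF anti, of q] left_continuous[of q] by (cases "q \<le> p") auto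

lemma right_limit: "0 \<le> q \<Longrightarrow> q < 1 \<Longrightarrow> \<exists>l. (f \<longlongrightarrow> l) (at_right q)"
  using mono_tendsto_at_right[OF mono, of q] right_continuous[of q] by (cases "p \<le> q") auto

text \<open>Away from the special points each branch is already continuous on one side, so a
  discontinuity must show on the side where monotone functions have countably many.\<close>

lemma discontinuities_subset:
  "discontinuities f \<subseteq> insert 0 (insert 1 (insert p
    ({q \<in> {0<..p}. \<not> (f \<longlongrightarrow> f q) (at_left q)} \<union> {q \<in> {p..<1}. \<not> (f \<longlongrightarrow> f q) (at_right q)})))"
proof
  fix q assume "q \<in> discontinuities f"
  then have q: "0 \<le> q" "q \<le> 1" "\<not> (f \<longlongrightarrow> f q) (at q within {0..1})"
    by (auto simp: discontinuities_def continuous_within)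
  show "q \<in> insert 0 (insert 1 (insert p
    ({q \<in> {0<..p}. \<not> (f \<longlongrightarrow> f q) (at_left q)} \<union> {q \<in> {p..<1}. \<not> (f \<longlongrightarrow> f q) (at_right q)})))"
  proof (cases "q = 0 \<or> q = 1 \<or> q = p")
    case False
    then have "\<not> (f \<longlongrightarrow> f q) (at_left q) \<or> \<not> (f \<longlongrightarrow> f q) (at_right q)"
      using q at_within_unit(3)[of q] by (auto intro: filterlim_sup)
    then show ?thesis
      using False q right_continuous[of q] left_continuous[of q] by (cases "q < p") auto
  qed auto
qed

lemma countable_discontinuities: "countable (discontinuities f)"
  by (rule countable_subset[OF discontinuities_subset])
    (intro countable_insert countable_Un antimono_countable_left_discont[OF anti]
      mono_countable_right_discont[OF mono])

text \<open>At an interior point one of the two limits equals the value, by one-sided continuity off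
  \<open>p\<close> and by \<open>centre\<close> at \<open>p\<close>; equal limits would then force
  continuity. The assumption \<open>centre\<close> excludes an isolated dip at
  \<open>p\<close>.\<close>

lemma discontinuity_is_jump:
  assumes centre: "0 < p \<Longrightarrow> p < 1 \<Longrightarrow> (f \<longlongrightarrow> f p) (at_left p) \<or> (f \<longlongrightarrow> f p) (at_right p)"
    and "q \<in> discontinuities f"
  shows "is_jump f q"
proof -
  have q: "0 \<le> q" "q \<le> 1" "\<not> (f \<longlongrightarrow> f q) (at q within {0..1})"
    using assms(2) by (auto simp: discontinuities_def continuous_within)
  consider "q = 0" | "q = 1" | "0 < q" "q < 1" using q by linarith
  then show ?thesis
  proof cases
    case 1
    then show ?thesis
      using q right_limit[of 0] by (auto simp: is_jump_def at_within_Icc_at_right)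
  next
    case 2
    then show ?thesis
      using q left_limit[of 1] by (auto simp: is_jump_def at_within_Icc_at_left)
  next
    case 3
    then obtain l r where lr: "(f \<longlongrightarrow> l) (at_left q)" "(f \<longlongrightarrow> r) (at_right q)"
      using left_limit[of q] right_limit[of q] by auto
    have "l = f q \<or> r = f q"
    proof (cases q p rule: linorder_cases)
      case less
      then show ?thesis
        using right_continuous[of q] 3 lr(2) tendsto_unique[OF trivial_limit_at_right_real] by auto
    next
      case equal
      then show ?thesis
        using centre 3 lr tendsto_unique[OF trivial_limit_at_right_real] tendsto_unique[OF trivial_limit_at_left_real] by auto
    next
      case greater
      then show ?thesis
        using left_continuous[of q] 3 lr(1) tendsto_unique[OF trivial_limit_at_left_real] by auto
    qed
    moreover have "l \<noteq> r"
    proof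
      assume "l = r"
      with \<open>l = f q \<or> r = f q\<close> have "(f \<longlongrightarrow> f q) (at q within {0..1})"
        using lr 3 by (auto simp: at_within_unit(3) intro: filterlim_sup)
      with q show False by simp
    qed
    ultimately show ?thesis using lr 3 by (auto simp: is_jump_def)
  qed
qed

end

section \<open>Discontinuities of the rate function\<close>

context cost_setting
begin

lemma valley_Q: "valley Q \<nu>A"
proof
  show "antimono_on {0..\<nu>A} Q" "mono_on {\<nu>A..1} Q"
    by (auto intro!: monotone_onI Q_mono_weak)
qed (simp_all add: lower_semicontinuous_Q)

sublocale valley Q \<nu>A by (rule valley_Q)

lemma Q_centre:
  assumes "0 < \<nu>A" "\<nu>A < 1"
  shows "(Q \<longlongrightarrow> Q \<nu>A) (at_left \<nu>A) \<or> (Q \<longlongrightarrow> Q \<nu>A) (at_right \<nu>A)"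
proof -
  have Q\<nu>: "Q \<nu>A = 0" by (simp add: Q_zero_iff)
  \<comment> \<open>Arbitrarily small rates on one side of \<open>\<nu>A\<close> suffice, since
    monotonicity turns them into a limit 0 on that side.\<close>
  let ?L = "\<forall>c>0. \<exists>x. gA A x < \<nu>A \<and> Q (gA A x) \<le> ennreal c"
  let ?R = "\<forall>c>0. \<exists>x. \<nu>A < gA A x \<and> Q (gA A x) \<le> ennreal c"
  have "?L \<or> ?R"
  proof (rule ccontr)
    assume "\<not> ?thesis"
    then obtain c1 c2 where c: "0 < c1" "\<And>x. gA A x < \<nu>A \<Longrightarrow> \<not> Q (gA A x) \<le> ennreal c1"
      "0 < c2" "\<And>x. \<nu>A < gA A x \<Longrightarrow> \<not> Q (gA A x) \<le> ennreal c2" by auto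
    obtain e1 where e1: "0 < e1" "\<And>x. \<bar>x\<bar> < e1 \<Longrightarrow> Q (gA A x) \<le> ennreal c1"
      using Q_small_near[OF c(1)] by auto
    obtain e2 where e2: "0 < e2" "\<And>x. \<bar>x\<bar> < e2 \<Longrightarrow> Q (gA A x) \<le> ennreal c2"
      using Q_small_near[OF c(3)] by auto
    \<comment> \<open>Near 0 the rate at \<open>gA A x\<close> is below both thresholds, which
      excludes values on either side of \<open>\<nu>A\<close>.\<close>
    have "gA A x = gA A 0" if "\<bar>x\<bar> < min e1 e2" for x
      using c(2)[of x] c(4)[of x] e1(2)[of x] e2(2)[of x] that gA_0 by force
    then have "\<nu>A = 0 \<or> \<nu>A = 1"
      using gA_locally_constant[of "min e1 e2"] e1(1) e2(1) gA_0 by auto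
    with assms show False by auto
  qed
  then show ?thesis
  proof
    assume L: ?L
    have "(INF y\<in>{0..<\<nu>A}. Q y) \<le> 0"
    proof (rule ennreal_le_epsilon)
      fix c :: real assume "0 < c"
      then obtain x where "gA A x < \<nu>A" "Q (gA A x) \<le> ennreal c" using L by auto
      then show "(INF y\<in>{0..<\<nu>A}. Q y) \<le> 0 + ennreal c"
        using gA_bounds[of x] by (auto intro: INF_lower2)
    qed
    then show ?thesis
      using antimono_tendsto_at_left[OF anti, of \<nu>A] assms by (simp add: Q\<nu>)
  next
    assume R: ?R
    have "(Q \<longlongrightarrow> 0) (at_right \<nu>A)"
    proof (rule order_tendstoI)
      fix c :: ennreal assume "0 < c"
      \<comment> \<open>Since \<open>c\<close> may be infinite, a finite positive bound below it is
        chosen first.\<close>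
      then obtain e where e: "0 < e" "e < c" using dense by blast
      then obtain c' where c': "0 < c'" "ennreal c' < c"
        by (cases e) auto
      obtain x where x: "\<nu>A < gA A x" "Q (gA A x) \<le> ennreal c'" using R c' by auto
      have "\<forall>\<^sub>F y in at_right \<nu>A. y \<in> {\<nu>A<..<gA A x}"
        using x by (intro eventually_at_rightI) auto
      then show "\<forall>\<^sub>F y in at_right \<nu>A. Q y < c"
      proof eventually_elim
        case (elim y)
        then have "Q y \<le> Q (gA A x)" by (intro Q_mono_weak) auto
        with x c' show ?case by (meson le_less_trans)
      qed
    qed simp
    then show ?thesis by (simp add: Q\<nu>)
  qed
qed

end

theorem proposition3p9:
  fixes b r :: nat and \<alpha> lam :: real and A :: "real set"
    and J :: "nat \<Rightarrow> real set" and lo hi :: "nat \<Rightarrow> ereal"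
  assumes "b \<ge> 2" and "\<alpha> > 0" and "lam > 0"
    and "A \<noteq> {}" and "A \<noteq> UNIV"
    and "r \<ge> 1"
    and "\<And>j. j < r \<Longrightarrow> lo j < hi j"
    and "\<And>j. j < r \<Longrightarrow> J j \<in> real_intervals (lo j) (hi j)"
    and "disjoint_family_on J {..<r}"
    and "A = (\<Union>j<r. J j)"
  shows
    "({q \<in> {0..1}. QA b \<alpha> lam A q < \<infinity>} = DA A
       \<and> (\<forall>q\<in>{0..1}. QA b \<alpha> lam A q = 0 \<longleftrightarrow> q = measure gauss A))
     \<and> (strict_antimono_on (DA A \<inter> {mA A..measure gauss A}) (QA b \<alpha> lam A)
       \<and> strict_mono_on (DA A \<inter> {measure gauss A..MA A}) (QA b \<alpha> lam A))
     \<and> (lower_semicontinuous_on {0..1} (QA b \<alpha> lam A)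
       \<and> (\<forall>q\<in>DA A \<inter> {mA A..<measure gauss A}. continuous (at_right q) (QA b \<alpha> lam A))
       \<and> (\<forall>q\<in>DA A \<inter> {measure gauss A<..MA A}. continuous (at_left q) (QA b \<alpha> lam A)))
     \<and> ((\<forall>q\<in>discontinuities (QA b \<alpha> lam A). is_jump (QA b \<alpha> lam A) q)
       \<and> countable (discontinuities (QA b \<alpha> lam A)))"
proof -
  interpret cost_setting r A J lo hi b \<alpha> lam
    using assms by unfold_locales auto
  have D01: "DA A \<subseteq> {0..1}"
    using gA_bounds by (auto simp: DA_def)
  show ?thesis
  proof (intro conjI ballI)
    show "{q \<in> {0..1}. Q q < \<infinity>} = DA A"
      using D01 Q_finite_iff by blast
    show "Q q = 0 \<longleftrightarrow> q = \<nu>A" for q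
      by (rule Q_zero_iff)
    \<comment> \<open>Membership in \<open>DA A\<close> makes the rate finite at the point farther
      from \<open>\<nu>A\<close>, as \<open>Q_strict\<close> requires.\<close>
    show "strict_antimono_on (DA A \<inter> {mA A..\<nu>A}) Q" "strict_mono_on (DA A \<inter> {\<nu>A..MA A}) Q"
      by (intro monotone_onI Q_strict; simp add: Q_finite_iff[unfolded infinity_ennreal_def])+
    show "lower_semicontinuous_on {0..1} Q"
      by (rule lower_semicontinuous_Q)
    show "continuous (at_right q) Q" if "q \<in> DA A \<inter> {mA A..<\<nu>A}" for q
      using that D01 right_continuous[of q] by (auto simp: continuous_within)
    show "continuous (at_left q) Q" if "q \<in> DA A \<inter> {\<nu>A<..MA A}" for q
      using that D01 left_continuous[of q] by (auto simp: continuous_within)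
    show "is_jump Q q" if "q \<in> discontinuities Q" for q
      using Q_centre that by (rule discontinuity_is_jump)
    show "countable (discontinuities Q)"
      by (rule countable_discontinuities)
  qed
qed

end
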